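(* Let $d\ge 1$, $T>0$, $R>0$ and $p>1$. Let $b:\mathbb{R}^d\to\mathbb{R}^d$ be a bounded (autonomous) vector field belonging to $W^{1,p}(\mathbb{R}^d;\mathbb{R}^d)$, such that $b$ satisfies the one-sided Lipschitz condition on every compact set and $[\mathrm{div}\, b]^{-}\in L^{\infty}(\mathbb{R}^d)$. Let $X:[0,T]\times\mathbb{R}^d\to\mathbb{R}^d$ be a regular Lagrangian flow associated to $b$. Then there exist constants $C>0$, $\kappa>0$ and $K\ge 0$, independent of the time step $h$ and of the index $n$, such that, setting $t_0=0$ and $$C_{\exp}=\exp\left\{(T-t_0)\left(2\kappa+K(T-t_0)\right)\right\},$$ for every integer $N\ge 1$, with $h=T/N$ and $t_n=nh$, the Euler approximations $X_n$ with time step $h$ satisfy, for every $n\in\{0,1,\dots,N\}$, $$\left\|X(t_n)-X_n\right\|_{L^p(B_R(0))}\le C\sqrt{\frac{C_{\exp}-1}{2\kappa}}\;h^{1/2}+C_{\exp}\left\|X(t_0)-X_0\right\|_{L^p(B_R(0))}.$$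
   Context: Notation: $m$ is Lebesgue measure on $\mathbb{R}^d$; $B_R(0)$ is the ball of radius $R$ centred at $0$ in $\mathbb{R}^d$; $[\mathrm{div}\,b]^-$ is the negative part of the distributional divergence of $b$; $f_{\#}\mu$ denotes the push-forward of a measure $\mu$ under a measurable map $f$. Regular Lagrangian flow: a map $X:[0,T]\times\mathbb{R}^d\to\mathbb{R}^d$ is a regular Lagrangian flow for the vector field $b$ if (i) for $m$-a.e. $x\in\mathbb{R}^d$ the map $t\mapsto X(t,x)$ is an absolutely continuous integral solution of $\gamma'(t)=b(\gamma(t))$ for $t\in[0,T]$ with $\gamma(0)=x$, that is, $X(t,x)=x+\int_0^t b(X(s,x))\,ds$ for $0\le t\le T$; and (ii) there is a constant $L$ independent of $t$ such that $X(t,\cdot)_{\#}m\le L\,m$ for all $t\in[0,T]$. One-sided Lipschitz condition on every compact set (autonomous case): for every compact set $Q\subset\mathbb{R}^d$ there is a constant $\nu_Q\in\mathbb{R}$ such that $\langle b(x)-b(\tilde x),x-\tilde x\rangle\le \nu_Q|x-\tilde x|^2$ for a.e. $(x,\tilde x)\in Q\times Q$. Euler scheme: for a time step $h>0$ and $x\in\mathbb{R}^d$, define $X_0=X_0(x)=x$ and $X_{n+1}(x)=X_n(x)+h\,b(X_n(x))$ for $n=0,1,\dots$. $X(t_n)$ denotes the function $x\mapsto X(t_n,x)$ and $X_n$ the function $x\mapsto X_n(x)$; the $L^p(B_R(0))$ norms are taken with respect to the initial point $x$. *)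

theory Defs
  imports "HOL-Analysis.Analysis"
begin

section \<open>Lebesgue spaces\<close>

text \<open>Finite exponents only. The measure is the completed Lebesgue measure \<^const>\<open>lebesgue\<close>.\<close>

definition in_Lp :: "real \<Rightarrow> ('a::euclidean_space \<Rightarrow> 'b::euclidean_space) \<Rightarrow> bool" where
  "in_Lp p f \<longleftrightarrow> f \<in> borel_measurable lebesgue \<and> integrable lebesgue (\<lambda>x. norm (f x) powr p)"

definition in_Linfty :: "('a::euclidean_space \<Rightarrow> 'b::euclidean_space) \<Rightarrow> bool" where
  "in_Linfty f \<longleftrightarrow> f \<in> borel_measurable lebesgue \<and> (\<exists>M. AE x in lebesgue. norm (f x) \<le> M)"

text \<open>The norm takes values in \<^typ>\<open>ennreal\<close>, so an infinite norm is not confused with a small one.\<close>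

definition Lp_norm_on :: "real \<Rightarrow> 'a set \<Rightarrow> ('a::euclidean_space \<Rightarrow> 'b::euclidean_space) \<Rightarrow> ennreal" where
  "Lp_norm_on p S f =
     (let I = (\<integral>\<^sup>+ x\<in>S. ennreal (norm (f x) powr p) \<partial>lebesgue)
      in if I = \<infinity> then \<infinity> else ennreal (enn2real I powr (1 / p)))"

definition loc_integrable :: "('a::euclidean_space \<Rightarrow> 'b::euclidean_space) \<Rightarrow> bool" where
  "loc_integrable f \<longleftrightarrow> (\<forall>Q. compact Q \<longrightarrow> f absolutely_integrable_on Q)"

section \<open>Test functions, weak derivatives, distributional divergence\<close>

primrec C_k :: "nat \<Rightarrow> ('a::euclidean_space \<Rightarrow> real) \<Rightarrow> bool" where
  "C_k 0 f \<longleftrightarrow> continuous_on UNIV f"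
| "C_k (Suc k) f \<longleftrightarrow>
     (\<forall>x. f differentiable (at x)) \<and>
     (\<forall>i\<in>Basis. C_k k (\<lambda>x. frechet_derivative f (at x) i))"

definition test_function :: "('a::euclidean_space \<Rightarrow> real) \<Rightarrow> bool" where
  "test_function \<phi> \<longleftrightarrow> (\<forall>k. C_k k \<phi>) \<and> compact (closure {x. \<phi> x \<noteq> 0})"

definition has_weak_partial ::
    "'a \<Rightarrow> ('a::euclidean_space \<Rightarrow> 'b::euclidean_space) \<Rightarrow> ('a \<Rightarrow> 'b) \<Rightarrow> bool" where
  "has_weak_partial i f g \<longleftrightarrow>
     loc_integrable f \<and> loc_integrable g \<and>
     (\<forall>\<phi>. test_function \<phi> \<longrightarrow>
        (\<integral>x. frechet_derivative \<phi> (at x) i *\<^sub>R f x \<partial>lebesgue) = - (\<integral>x. \<phi> x *\<^sub>R g x \<partial>lebesgue))"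

definition in_W1p :: "real \<Rightarrow> ('a::euclidean_space \<Rightarrow> 'b::euclidean_space) \<Rightarrow> bool" where
  "in_W1p p f \<longleftrightarrow> in_Lp p f \<and> (\<forall>i\<in>Basis. \<exists>g. in_Lp p g \<and> has_weak_partial i f g)"

text \<open>
  The distributional divergence of \<open>b\<close> is represented by the locally integrable function \<open>D\<close>
  (unique up to null sets). The term \<open>frechet_derivative \<phi> (at x) (b x)\<close> is the inner product
  of the gradient of \<open>\<phi>\<close> at \<open>x\<close> with \<open>b x\<close>.
\<close>

definition has_distributional_div ::
    "('a::euclidean_space \<Rightarrow> 'a) \<Rightarrow> ('a \<Rightarrow> real) \<Rightarrow> bool" where
  "has_distributional_div b D \<longleftrightarrow>
     loc_integrable b \<and> loc_integrable D \<and>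
     (\<forall>\<phi>. test_function \<phi> \<longrightarrow>
        (\<integral>x. frechet_derivative \<phi> (at x) (b x) \<partial>lebesgue) = - (\<integral>x. \<phi> x * D x \<partial>lebesgue))"

section \<open>One-sided Lipschitz condition, regular Lagrangian flow, Euler scheme\<close>

text \<open>``Almost every pair'' refers to Lebesgue measure on the product space.\<close>

definition one_sided_Lipschitz_on_compacts :: "('a::euclidean_space \<Rightarrow> 'a) \<Rightarrow> bool" where
  "one_sided_Lipschitz_on_compacts b \<longleftrightarrow>
     (\<forall>Q. compact Q \<longrightarrow>
        (\<exists>\<nu>::real. AE z in (lebesgue :: ('a \<times> 'a) measure). z \<in> Q \<times> Q \<longrightarrow>
           (b (fst z) - b (snd z)) \<bullet> (fst z - snd z) \<le> \<nu> * (norm (fst z - snd z))\<^sup>2))"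

text \<open>
  Absolute continuity of \<open>t \<mapsto> X t x\<close> is contained in the integral equation, since the
  integrand is Lebesgue integrable. Measurability of \<open>X t\<close> is what makes the push-forward
  \<open>distr lebesgue borel (X t)\<close> meaningful.
\<close>

definition regular_Lagrangian_flow ::
    "real \<Rightarrow> ('a::euclidean_space \<Rightarrow> 'a) \<Rightarrow> (real \<Rightarrow> 'a \<Rightarrow> 'a) \<Rightarrow> bool" where
  "regular_Lagrangian_flow T b X \<longleftrightarrow>
     (AE x in lebesgue.
        (\<lambda>s. b (X s x)) absolutely_integrable_on {0..T} \<and>
        (\<forall>t\<in>{0..T}. X t x = x + integral {0..t} (\<lambda>s. b (X s x)))) \<and>
     (\<forall>t\<in>{0..T}. X t \<in> borel_measurable lebesgue) \<and>
     (\<exists>L::real. \<forall>t\<in>{0..T}. \<forall>A\<in>sets borel.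
        emeasure (distr lebesgue borel (X t)) A \<le> ennreal L * emeasure lebesgue A)"

primrec euler :: "('a::real_vector \<Rightarrow> 'a) \<Rightarrow> real \<Rightarrow> nat \<Rightarrow> 'a \<Rightarrow> 'a" where
  "euler b h 0 x = x"
| "euler b h (Suc n) x = euler b h n x + h *\<^sub>R b (euler b h n x)"

end

theory Submission
  imports Defs
begin

text \<open>
  A trace argument turns the bound on the negative part of the divergence and the one-sided Lipschitz
  condition into the two-sided estimate \<open>\<bar>(b x - b y) \<bullet> (x - y)\<bar> \<le> \<nu> * (norm (x - y))\<^sup>2\<close>
  for all \<open>x\<close>, \<open>y\<close> in the bounded part of a set \<open>G\<close> of full measure: it is first proved
  in weak form against test functions, where no derivative of \<open>b\<close> appears, and then made pointwise.
  For small \<open>h\<close> the map \<open>x \<mapsto> x + h b(x)\<close> is therefore injective on that bounded part, with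
  Lipschitz inverse, so the Euler iterates stay in \<open>G\<close> for almost every starting point; the flow does
  so by its bounded compression. Along such a trajectory, comparing \<open>b (X s)\<close> with \<open>b X\<^sub>n\<close>
  through the pair \<open>(X s, X\<^sub>n)\<close>, rather than through the regularity of \<open>b\<close> along the flow, shows
  that one step multiplies the squared error by at most \<open>1 + 4 \<nu> h\<close> and adds \<open>O(h\<^sup>2)\<close>. The error
  is thus \<open>O(\<surd>h)\<close> for almost every starting point, which is stronger than the \<open>L\<^sup>p\<close> bound.
\<close>

section \<open>Smooth approximations of box indicators\<close>

text \<open>The bounds on \<open>b\<close> hold only almost everywhere, but the scheme evaluates
  \<open>b\<close> at single points. An upper one-sided bound alone does not keep an Euler step from
  collapsing a set of positive measure: in one dimension \<open>x + h b(x)\<close> is constant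
  wherever \<open>b\<close> has slope \<open>-1/h\<close>. For small \<open>h\<close> the lower
  bound excludes this. Its size is found formally from the symmetric part of the Jacobian: if its
  quadratic form is at most \<open>\<nu>\<close> on unit vectors and its trace is at least
  \<open>-\<mu>\<close>, then on any unit vector it is at least \<open>-\<mu> - (d-1) \<nu>\<close>,
  because the other \<open>d-1\<close> directions of an orthonormal basis contribute at most
  \<open>(d-1) \<nu>\<close>. The rate comes from \<open>T/h\<close> steps, each adding
  \<open>O(h^2)\<close> to the squared error. The constant \<open>C\<close> may depend on everything
  except \<open>h\<close> and \<open>n\<close>, so it absorbs the measure of the ball, the growth
  factor and the steps too large for injectivity; \<open>\<kappa> = 1\<close> and
  \<open>K = 0\<close> then suffice.\<close>

definition flat_exp :: "nat \<Rightarrow> real \<Rightarrow> real" where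
  "flat_exp m t = (if t > 0 then exp (- 1 / t) / t ^ m else 0)"

text \<open>\<open>flat_exp 0\<close> is the classical smooth function that is flat at 0. Dividing
  it by powers of \<open>t\<close> gives a family whose span is closed under differentiation, so
  this one formula yields all orders by induction. Only \<open>t = 0\<close> needs a limit: in terms
  of \<open>1/t\<close>, exponential decay beats any power.\<close>

lemma flat_exp_has_derivative:
  "(flat_exp m has_real_derivative (flat_exp (m + 2) t - real m * flat_exp (Suc m) t)) (at t)"
proof (cases t "0 :: real" rule: linorder_cases)
  case greater
  have "((\<lambda>t. exp (- 1 / t) / t ^ m) has_real_derivative
      (flat_exp (m + 2) t - real m * flat_exp (Suc m) t)) (at t)"
  proof -
    have e: "((\<lambda>t. exp (- 1 / t)) has_real_derivative exp (- 1 / t) / t\<^sup>2) (at t)"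
      using greater by (auto intro!: derivative_eq_intros simp: power2_eq_square)
    have p: "((\<lambda>t. t ^ m) has_real_derivative real m * t ^ (m - Suc 0)) (at t)"
      by (rule DERIV_pow)
    have "(exp (- 1 / t) / t\<^sup>2 * t ^ m - real m * t ^ (m - Suc 0) * exp (- 1 / t)) / (t ^ m) ^ Suc (Suc 0) =
        flat_exp (m + 2) t - real m * flat_exp (Suc m) t"
      using greater by (cases m) (auto simp: flat_exp_def field_simps power2_eq_square)
    then show ?thesis
      using DERIV_quotient[OF e p] greater by simp
  qed
  moreover have "eventually (\<lambda>s. flat_exp m s = exp (- 1 / s) / s ^ m) (nhds t)"
    using eventually_nhds_in_open[of "{0<..}" t] greater
    by (auto simp: flat_exp_def elim!: eventually_mono)
  ultimately show ?thesis
    by (subst DERIV_cong_ev[OF refl _ refl])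
next
  case less
  have "((\<lambda>t. 0) has_real_derivative (flat_exp (m + 2) t - real m * flat_exp (Suc m) t)) (at t)"
    using less by (auto simp: flat_exp_def)
  moreover have "eventually (\<lambda>s. flat_exp m s = 0) (nhds t)"
    using eventually_nhds_in_open[of "{..<0}" t] less
    by (auto simp: flat_exp_def elim!: eventually_mono)
  ultimately show ?thesis
    by (subst DERIV_cong_ev[OF refl _ refl])
next
  case equal
  have "((\<lambda>h. flat_exp m h / h) \<longlongrightarrow> 0) (at_right 0)"
  proof (rule Lim_transform_eventually)
    show "((\<lambda>h::real. exp (- 1 / h) / h ^ Suc m) \<longlongrightarrow> 0) (at_right 0)"
    proof -
      have "((\<lambda>h::real. inverse h ^ Suc m / exp (inverse h)) \<longlongrightarrow> 0) (at_right 0)"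
        using filterlim_compose[OF tendsto_power_div_exp_0 filterlim_inverse_at_top_right] .
      then show ?thesis
        by (simp add: divide_inverse exp_minus power_inverse mult.commute)
    qed
    show "eventually (\<lambda>h. exp (- 1 / h) / h ^ Suc m = flat_exp m h / h) (at_right 0)"
      by (auto simp: flat_exp_def eventually_at_filter)
  qed
  moreover have "((\<lambda>h. flat_exp m h / h) \<longlongrightarrow> 0) (at_left 0)"
    by (rule Lim_transform_eventually[OF tendsto_const])
       (auto simp: flat_exp_def eventually_at_filter)
  ultimately have "((\<lambda>h. flat_exp m h / h) \<longlongrightarrow> 0) (at 0)"
    by (simp add: filterlim_split_at)
  with equal show ?thesis
    by (simp add: DERIV_def flat_exp_def)
qed

section \<open>Closure properties of the classes \<open>C_k\<close>\<close>

lemma C_k_const: "C_k k (\<lambda>x. c)"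
  by (induction k arbitrary: c) (auto simp: frechet_derivative_const)

lemma C_k_Suc_imp: "C_k (Suc k) f \<Longrightarrow> C_k k f"
proof (induction k arbitrary: f)
  case 0
  then show ?case
    by (auto simp: continuous_on_eq_continuous_at differentiable_imp_continuous_within)
qed simp

lemma C_k_add:
  assumes "C_k k f" "C_k k g"
  shows "C_k k (\<lambda>x. f x + g x)"
  using assms
proof (induction k arbitrary: f g)
  case 0
  then show ?case by (auto intro: continuous_intros)
next
  case (Suc k)
  then have "frechet_derivative (\<lambda>x. f x + g x) (at x) =
      (\<lambda>v. frechet_derivative f (at x) v + frechet_derivative g (at x) v)" for x
    by (intro frechet_derivative_at[symmetric] has_derivative_add)
       (auto simp: frechet_derivative_works)
  with Suc show ?case by auto
qed

lemma C_k_mult: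
  assumes "C_k k f" "C_k k g"
  shows "C_k k (\<lambda>x. f x * g x)"
  using assms
proof (induction k arbitrary: f g)
  case 0
  then show ?case by (auto intro: continuous_intros)
next
  case (Suc k)
  then have "frechet_derivative (\<lambda>x. f x * g x) (at x) =
      (\<lambda>v. f x * frechet_derivative g (at x) v + frechet_derivative f (at x) v * g x)" for x
    by (intro frechet_derivative_at[symmetric] has_derivative_mult)
       (auto simp: frechet_derivative_works)
  \<comment> \<open>The product rule leaves one factor undifferentiated in each term, so
    \<open>f\<close> and \<open>g\<close> themselves are needed at the lower order.\<close>
  moreover have "C_k k f" "C_k k g"
    using Suc.prems by (auto intro: C_k_Suc_imp simp del: C_k.simps(2))
  ultimately show ?case
    using Suc by (auto intro!: C_k_add)
qed

lemma C_k_prod: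
  assumes "finite I" "\<And>i. i \<in> I \<Longrightarrow> C_k k (f i)"
  shows "C_k k (\<lambda>x. \<Prod>i\<in>I. f i x)"
  using assms by (induction rule: finite_induct) (auto intro: C_k_mult C_k_const)

text \<open>The affine argument covers each coordinate in both directions and at every scale, as a
  product over the faces of a box requires. \<open>m\<close> varies in the induction because each
  derivative raises it.\<close>

lemma C_k_flat_exp:
  "C_k k (\<lambda>x :: 'a::euclidean_space. flat_exp m (x \<bullet> w + c))"
proof (induction k arbitrary: m)
  case 0
  have "isCont (flat_exp m) t" for t
    using flat_exp_has_derivative DERIV_isCont by blast
  then have "continuous_on UNIV (flat_exp m)"
    by (simp add: continuous_on_eq_continuous_at)
  then have "continuous_on UNIV (flat_exp m \<circ> (\<lambda>x :: 'a. x \<bullet> w + c))"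
    by (intro continuous_on_compose continuous_intros) (auto intro: continuous_on_subset)
  then show ?case by (simp add: o_def)
next
  case (Suc k)
  have der: "((\<lambda>x. flat_exp m (x \<bullet> w + c)) has_derivative
      (\<lambda>v. (v \<bullet> w) * (flat_exp (m + 2) (x \<bullet> w + c) - real m * flat_exp (Suc m) (x \<bullet> w + c)))) (at x)"
    for x :: 'a
    by (rule DERIV_compose_FDERIV[OF flat_exp_has_derivative, THEN has_derivative_eq_rhs])
       (auto intro!: derivative_eq_intros)
  have "frechet_derivative (\<lambda>x. flat_exp m (x \<bullet> w + c)) (at x) =
      (\<lambda>v. (v \<bullet> w) * (flat_exp (m + 2) (x \<bullet> w + c) + (- real m) * flat_exp (Suc m) (x \<bullet> w + c)))"
    for x :: 'a
    using frechet_derivative_at[OF der, symmetric] by simp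
  moreover have "(\<lambda>x. flat_exp m (x \<bullet> w + c)) differentiable (at x)" for x :: 'a
    using der by (auto simp: differentiable_def)
  moreover have "C_k k (\<lambda>x. (i \<bullet> w) * (flat_exp (m + 2) (x \<bullet> w + c) +
      (- real m) * flat_exp (Suc m) (x \<bullet> w + c)))" for i :: 'a
    by (intro C_k_mult C_k_add C_k_const Suc)
  ultimately show ?case
    unfolding C_k.simps by presburger
qed

text \<open>Each factor is \<open>flat_exp 0\<close> at \<open>Suc n\<close> times the signed
  distance to one face: it vanishes beyond that face and tends to 1 strictly inside. The bound by 1
  and the common support make dominated convergence available.\<close>

lemma indicator_box_approx:
  fixes a b :: "'a::euclidean_space"
  obtains \<phi> :: "nat \<Rightarrow> 'a \<Rightarrow> real"
  where "\<And>n. test_function (\<phi> n)" "\<And>n x. 0 \<le> \<phi> n x" "\<And>n x. \<phi> n x \<le> 1"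
    "\<And>n x. x \<notin> box a b \<Longrightarrow> \<phi> n x = 0"
    "\<And>x. (\<lambda>n. \<phi> n x) \<longlonglongrightarrow> indicator (box a b) x"
proof -
  define \<phi> :: "nat \<Rightarrow> 'a \<Rightarrow> real" where "\<phi> n x = (\<Prod>i\<in>Basis. 
     flat_exp 0 (x \<bullet> (real (Suc n) *\<^sub>R i) + (- real (Suc n) * (a \<bullet> i))) *
     flat_exp 0 (x \<bullet> (- real (Suc n) *\<^sub>R i) + real (Suc n) * (b \<bullet> i)))" for n x
  have eq: "\<phi> n x = (\<Prod>i\<in>Basis. flat_exp 0 (real (Suc n) * (x \<bullet> i - a \<bullet> i)) *
     flat_exp 0 (real (Suc n) * (b \<bullet> i - x \<bullet> i)))" for n x
    unfolding \<phi>_def by (simp add: algebra_simps)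
  have fe: "0 \<le> flat_exp 0 t" "flat_exp 0 t \<le> 1" "t \<le> 0 \<Longrightarrow> flat_exp 0 t = 0" for t
    by (auto simp: flat_exp_def)
  have lim: "(\<lambda>n. flat_exp 0 (real (Suc n) * t)) \<longlonglongrightarrow> 1" if "t > 0" for t
  proof -
    have "(\<lambda>n. exp (- 1 / (real (Suc n) * t))) \<longlonglongrightarrow> 1"
    proof -
      have "(\<lambda>n. exp (- (1 / t) * inverse (real (Suc n)))) \<longlonglongrightarrow> exp (- (1 / t) * 0)"
        by (intro tendsto_intros LIMSEQ_inverse_real_of_nat)
      then show ?thesis
        by (simp add: divide_inverse mult.commute)
    qed
    with that show ?thesis by (simp add: flat_exp_def)
  qed
  have zero: "\<phi> n x = 0" if out: "x \<notin> box a b" for n x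
  proof -
    obtain i where i: "i \<in> Basis" "x \<bullet> i - a \<bullet> i \<le> 0 \<or> b \<bullet> i - x \<bullet> i \<le> 0"
      using out by (force simp: mem_box)
    then have "real (Suc n) * (x \<bullet> i - a \<bullet> i) \<le> 0 \<or> real (Suc n) * (b \<bullet> i - x \<bullet> i) \<le> 0"
      by (auto simp: mult_le_0_iff)
    with i fe(3) show ?thesis
      unfolding eq by (intro prod_zero) auto
  qed
  show ?thesis
  proof
    show "test_function (\<phi> n)" for n
      unfolding test_function_def
    proof (intro conjI allI)
      show "C_k k (\<phi> n)" for k
        unfolding \<phi>_def by (intro C_k_prod C_k_mult C_k_flat_exp) simp
      have "{x. \<phi> n x \<noteq> 0} \<subseteq> cbox a b"
        using zero box_subset_cbox by blast
      then have "bounded {x. \<phi> n x \<noteq> 0}"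
        using bounded_cbox bounded_subset by blast
      then show "compact (closure {x. \<phi> n x \<noteq> 0})" by simp
    qed
    show "0 \<le> \<phi> n x" for n x
      unfolding eq by (intro prod_nonneg) (auto simp: fe)
    show "\<phi> n x \<le> 1" for n x
      unfolding eq by (intro prod_le_1) (auto simp: fe mult_le_one)
    show "\<phi> n x = 0" if "x \<notin> box a b" for n x
      using zero that .
    show "(\<lambda>n. \<phi> n x) \<longlonglongrightarrow> indicator (box a b) x" for x
    proof (cases "x \<in> box a b")
      case True
      then have "(\<lambda>n. flat_exp 0 (real (Suc n) * (x \<bullet> i - a \<bullet> i)) *
          flat_exp 0 (real (Suc n) * (b \<bullet> i - x \<bullet> i))) \<longlonglongrightarrow> 1 * 1" if "i \<in> Basis" for i
        using that by (intro tendsto_mult lim) (auto simp: mem_box)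
      from tendsto_prod[of Basis, OF this] have "(\<lambda>n. \<phi> n x) \<longlonglongrightarrow> (\<Prod>i\<in>(Basis :: 'a set). 1 * 1)"
        unfolding eq by simp
      with True show ?thesis by simp
    qed (simp add: zero)
  qed
qed

section \<open>Calculus of test functions\<close>

lemma integrable_bounded_support:
  fixes f :: "'a::euclidean_space \<Rightarrow> 'b::{banach, second_countable_topology}"
  assumes "f \<in> borel_measurable borel" "\<And>x. norm (f x) \<le> C" "\<And>x. x \<notin> cball a r \<Longrightarrow> f x = 0"
  shows "integrable lborel f"
proof (rule Bochner_Integration.integrable_bound)
  show "integrable lborel (\<lambda>x :: 'a. C * indicator (cball a r) x)"
    using emeasure_lborel_cball_finite
    by (intro integrable_mult_right integrable_real_indicator) auto
  show "f \<in> borel_measurable lborel" using assms(1) by simp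
  show "AE x in lborel. norm (f x) \<le> norm (C * indicator (cball a r) x)"
    using assms(2,3) order_trans[OF assms(2) abs_ge_self] by (intro AE_I2) (auto split: split_indicator)
qed

lemma has_derivative_test_function:
  "test_function \<phi> \<Longrightarrow> (\<phi> has_derivative frechet_derivative \<phi> (at x)) (at x)"
  using frechet_derivative_works C_k.simps(2) unfolding test_function_def by metis

lemma linear_derivative_test_function:
  "test_function \<phi> \<Longrightarrow> linear (frechet_derivative \<phi> (at x))"
  using has_derivative_linear has_derivative_test_function by blast

lemma continuous_test_function: "test_function \<phi> \<Longrightarrow> continuous_on S \<phi>"
  unfolding test_function_def by (metis C_k.simps(1) continuous_on_subset subset_UNIV)

lemma derivative_test_function_expand:
  assumes "test_function \<phi>"
  shows "frechet_derivative \<phi> (at x) v = (\<Sum>i\<in>Basis. (v \<bullet> i) * frechet_derivative \<phi> (at x) i)"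
  using linear_derivative_test_function[OF assms, of x]
  by (subst (1) euclidean_representation[of v, symmetric]) (simp add: linear_sum linear_scale)

lemma continuous_derivative_test_function:
  assumes "test_function \<phi>"
  shows "continuous_on S (\<lambda>x. frechet_derivative \<phi> (at x) v)"
proof -
  have "continuous_on UNIV (\<lambda>x. frechet_derivative \<phi> (at x) i)" if "i \<in> Basis" for i
    using assms that unfolding test_function_def by (metis C_k.simps)
  then have "continuous_on UNIV (\<lambda>x. frechet_derivative \<phi> (at x) v)"
    by (subst derivative_test_function_expand[OF assms]) (intro continuous_intros; simp)
  then show ?thesis
    by (rule continuous_on_subset) simp
qed

lemma eq_0_outside_support:
  assumes "x \<notin> closure {x. f x \<noteq> 0}"
  shows "f x = 0"
proof (rule ccontr)
  assume "f x \<noteq> 0"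
  then have "x \<in> {x. f x \<noteq> 0}" by simp
  with assms closure_subset show False by (metis subsetD)
qed

lemma derivative_test_function_zero:
  assumes "test_function \<phi>" "x \<notin> closure {x. \<phi> x \<noteq> 0}"
  shows "frechet_derivative \<phi> (at x) v = 0"
proof -
  have zero: "\<phi> y = 0" if "y \<in> - closure {x. \<phi> x \<noteq> 0}" for y
    using that eq_0_outside_support[of y \<phi>] by simp
  have "eventually (\<lambda>y. \<phi> y = 0) (nhds x)"
    by (rule eventually_mono[OF eventually_nhds_in_open[of "- closure {x. \<phi> x \<noteq> 0}"] zero])
       (use assms(2) in auto)
  moreover have "\<phi> x = 0"
    by (rule zero) (use assms(2) in simp)
  ultimately have "(\<phi> has_derivative (\<lambda>v. 0)) (at x)"
    by (intro has_derivative_transform_eventually[OF has_derivative_const[of 0]])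
       (auto simp: eventually_at_filter elim: eventually_mono)
  then show ?thesis
    using frechet_derivative_at by metis
qed

lemma bounded_derivative_test_function:
  assumes "test_function \<phi>"
  obtains L where "\<And>x. \<bar>frechet_derivative \<phi> (at x) v\<bar> \<le> L"
proof -
  let ?K = "closure {x. \<phi> x \<noteq> 0}" and ?D = "\<lambda>x. frechet_derivative \<phi> (at x) v"
  have "compact (?D ` ?K)"
    using assms unfolding test_function_def
    by (intro compact_continuous_image continuous_derivative_test_function assms) auto
  then have "bounded (?D ` ?K)"
    by (rule compact_imp_bounded)
  then obtain L where L: "\<forall>y\<in>?D ` ?K. norm y \<le> L" "L > 0"
    unfolding bounded_pos by blast
  have "\<bar>?D x\<bar> \<le> L" for x
  proof (cases "x \<in> ?K")
    case True
    then have "?D x \<in> ?D ` ?K" by (rule imageI)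
    with L(1) show ?thesis by (metis real_norm_def)
  next
    case False
    from derivative_test_function_zero[OF assms this] L(2) show ?thesis by simp
  qed
  then show ?thesis by (rule that)
qed

lemma bounded_support_test_function:
  assumes "test_function \<phi>"
  obtains r where "closure {x. \<phi> x \<noteq> 0} \<subseteq> cball 0 r" "0 < r"
proof -
  have "bounded (closure {x. \<phi> x \<noteq> 0})"
    using assms compact_imp_bounded unfolding test_function_def by blast
  then obtain r where "0 < r" "\<forall>x\<in>closure {x. \<phi> x \<noteq> 0}. norm x \<le> r"
    unfolding bounded_pos by blast
  then have "closure {x. \<phi> x \<noteq> 0} \<subseteq> cball 0 r"
    by auto
  then show ?thesis
    using \<open>0 < r\<close> by (rule that)
qed

lemma bounded_test_function:
  assumes "test_function \<phi>"
  obtains L where "\<And>x. \<bar>\<phi> x\<bar> \<le> L"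
proof -
  let ?K = "closure {x. \<phi> x \<noteq> 0}"
  have "compact (\<phi> ` ?K)"
    using assms unfolding test_function_def
    by (intro compact_continuous_image continuous_test_function assms) auto
  then have "bounded (\<phi> ` ?K)"
    by (rule compact_imp_bounded)
  then obtain L where L: "\<forall>y\<in>\<phi> ` ?K. norm y \<le> L" "L > 0"
    unfolding bounded_pos by blast
  have "\<bar>\<phi> x\<bar> \<le> L" for x
  proof (cases "\<phi> x = 0")
    case False
    then have "x \<in> ?K"
      using eq_0_outside_support[of x \<phi>] by blast
    then have "\<phi> x \<in> \<phi> ` ?K" by (rule imageI)
    with L(1) show ?thesis by (metis real_norm_def)
  qed (use L in simp)
  then show ?thesis by (rule that)
qed

lemma frechet_derivative_translate:
  assumes "\<And>x. \<phi> differentiable (at x)"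
  shows "frechet_derivative (\<lambda>x. \<phi> (x - a)) (at x) = frechet_derivative \<phi> (at (x - a))"
proof -
  have "(\<phi> has_derivative frechet_derivative \<phi> (at (x - a))) (at (x - a))"
    using assms frechet_derivative_works by blast
  then have "((\<lambda>x. \<phi> (x - a)) has_derivative frechet_derivative \<phi> (at (x - a))) (at x)"
    by (rule has_derivative_compose[rotated, THEN has_derivative_eq_rhs])
       (auto intro!: derivative_eq_intros)
  then show ?thesis
    using frechet_derivative_at by metis
qed

lemma C_k_translate: "C_k k \<phi> \<Longrightarrow> C_k k (\<lambda>x. \<phi> (x - a))"
proof (induction k arbitrary: \<phi>)
  case 0
  then show ?case
    by (auto intro!: continuous_intros continuous_on_compose2[of UNIV \<phi>])
next
  case (Suc k)
  then have "(\<lambda>x. \<phi> (x - a)) differentiable (at x)" for x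
    by (intro differentiable_compose[of \<phi> "\<lambda>x. x - a"]) (auto intro!: derivative_intros)
  with Suc show ?case
    by (auto simp: frechet_derivative_translate)
qed

lemma test_function_translate:
  assumes "test_function \<phi>"
  shows "test_function (\<lambda>x. \<phi> (x - a))"
proof -
  obtain r where r: "closure {x. \<phi> x \<noteq> 0} \<subseteq> cball 0 r"
    using bounded_support_test_function[OF assms] .
  have "{x. \<phi> (x - a) \<noteq> 0} \<subseteq> cball a r"
  proof
    fix x
    assume "x \<in> {x. \<phi> (x - a) \<noteq> 0}"
    then have "x - a \<in> closure {x. \<phi> x \<noteq> 0}"
      using eq_0_outside_support[of "x - a" \<phi>] by blast
    with r have "x - a \<in> cball 0 r"
      by (rule subsetD)
    then show "x \<in> cball a r"
      by (simp add: dist_norm norm_minus_commute)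
  qed
  then have "bounded {x. \<phi> (x - a) \<noteq> 0}"
    using bounded_subset bounded_cball by blast
  with assms show ?thesis
    by (auto simp: test_function_def intro: C_k_translate)
qed

text \<open>The shift acts on the smooth factor, so \<open>f\<close> may be merely bounded and
  measurable. The limit is tested along sequences \<open>S\<close> in order to use dominated
  convergence.\<close>

lemma has_derivative_integral_translate_at_0:
  assumes \<phi>: "test_function \<phi>" and f: "f \<in> borel_measurable borel" "\<And>x. \<bar>f x\<bar> \<le> B"
  shows "((\<lambda>t. \<integral>x. \<phi> (x - t *\<^sub>R v) * f x \<partial>lborel) has_real_derivative
      - (\<integral>x. frechet_derivative \<phi> (at x) v * f x \<partial>lborel)) (at 0)"
  unfolding DERIV_def
proof (rule Lim_within_LIMSEQ, intro allI impI, elim conjE)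
  fix S :: "nat \<Rightarrow> real"
  assume S: "\<forall>n. S n \<noteq> 0 \<and> S n \<in> UNIV" "S \<longlonglongrightarrow> 0"
  \<comment> \<open>A bound on all shifts puts the supports of the translates in one ball of radius
    \<open>r + c * norm v\<close>, on which the quotients are at most \<open>L * B\<close> by the
    mean value theorem.\<close>
  obtain c where c: "\<And>n. \<bar>S n\<bar> \<le> c" "c > 0"
    using convergent_imp_Bseq[OF convergentI[OF S(2)]] unfolding Bseq_def real_norm_def by blast
  obtain L where L: "\<And>x. \<bar>frechet_derivative \<phi> (at x) v\<bar> \<le> L"
    using bounded_derivative_test_function[OF \<phi>, where v = v] by blast
  obtain L0 where L0: "\<And>x. \<bar>\<phi> x\<bar> \<le> L0"
    using bounded_test_function[OF \<phi>] by blast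
  obtain r where r: "closure {x. \<phi> x \<noteq> 0} \<subseteq> cball 0 r" "r > 0"
    using bounded_support_test_function[OF \<phi>] .
  have nonneg: "0 \<le> L" "0 \<le> L0" "0 \<le> B"
    using L[of 0] L0[of 0] f(2)[of 0] by linarith+
  have out: "\<phi> x = 0" if "x \<notin> cball 0 r" for x
    using that r eq_0_outside_support[of x \<phi>] by blast
  have out': "\<phi> (x - t *\<^sub>R v) = 0" if "x \<notin> cball 0 (r + c * norm v)" "\<bar>t\<bar> \<le> c" for x t
  proof (rule out)
    have "norm (t *\<^sub>R v) \<le> c * norm v" using that(2) by (simp add: mult_right_mono)
    then show "x - t *\<^sub>R v \<notin> cball 0 r"
      using that(1) norm_triangle_ineq[of "x - t *\<^sub>R v" "t *\<^sub>R v"] by auto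
  qed
  note [measurable] = f(1) borel_measurable_continuous_onI[OF continuous_test_function[OF \<phi>]]
    borel_measurable_continuous_onI[OF continuous_derivative_test_function[OF \<phi>]]
  have int: "integrable lborel (\<lambda>x. \<phi> (x - t *\<^sub>R v) * f x)" if "\<bar>t\<bar> \<le> c" for t
    using out'[OF _ that] L0 f(2) nonneg
    by (intro integrable_bounded_support[where C = "L0 * B" and a = 0 and r = "r + c * norm v"])
       (auto simp: abs_mult mult_mono)
  let ?q = "\<lambda>n x. (\<phi> (x - S n *\<^sub>R v) - \<phi> x) / S n * f x"
  have "(\<lambda>n. \<integral>x. ?q n x \<partial>lborel) \<longlonglongrightarrow> (\<integral>x. - frechet_derivative \<phi> (at x) v * f x \<partial>lborel)"
  proof (rule integral_dominated_convergence)
    show "integrable lborel (\<lambda>x :: 'a. L * B * indicator (cball 0 (r + c * norm v)) x)"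
      using emeasure_lborel_cball_finite
      by (intro integrable_mult_right integrable_real_indicator) auto
    have line: "((\<lambda>t. \<phi> (x - t *\<^sub>R v)) has_real_derivative
        - frechet_derivative \<phi> (at (x - t *\<^sub>R v)) v) (at t)" for x t
    proof -
      have "((\<lambda>t. \<phi> (x - t *\<^sub>R v)) has_derivative
          (\<lambda>s. frechet_derivative \<phi> (at (x - t *\<^sub>R v)) (- s *\<^sub>R v))) (at t)"
        by (rule has_derivative_compose[OF _ has_derivative_test_function[OF \<phi>]])
           (auto intro!: derivative_eq_intros)
      moreover have "(\<lambda>s. frechet_derivative \<phi> (at (x - t *\<^sub>R v)) (- s *\<^sub>R v)) =
          (*) (- frechet_derivative \<phi> (at (x - t *\<^sub>R v)) v)"
        using linear_derivative_test_function[OF \<phi>, of "x - t *\<^sub>R v"]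
        by (auto simp: linear_scale linear_neg)
      ultimately show ?thesis
        by (simp add: has_field_derivative_def)
    qed
    show "AE x in lborel. (\<lambda>n. ?q n x) \<longlonglongrightarrow> - frechet_derivative \<phi> (at x) v * f x"
    proof (intro AE_I2 tendsto_mult tendsto_const)
      fix x
      have "((\<lambda>h. (\<phi> (x - h *\<^sub>R v) - \<phi> x) / h) \<longlongrightarrow> - frechet_derivative \<phi> (at x) v) (at 0)"
        using line[of x 0] by (simp add: DERIV_def)
      then show "(\<lambda>n. (\<phi> (x - S n *\<^sub>R v) - \<phi> x) / S n) \<longlonglongrightarrow> - frechet_derivative \<phi> (at x) v"
        using S by (auto simp: tendsto_at_iff_sequentially o_def)
    qed
    show "AE x in lborel. norm (?q n x) \<le> L * B * indicator (cball 0 (r + c * norm v)) x" for n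
    proof (rule AE_I2)
      fix x
      have "\<bar>\<phi> (x - S n *\<^sub>R v) - \<phi> (x - 0 *\<^sub>R v)\<bar> \<le> L * \<bar>S n - 0\<bar>"
        using field_differentiable_bound[of UNIV "\<lambda>t. \<phi> (x - t *\<^sub>R v)"
            "\<lambda>t. - frechet_derivative \<phi> (at (x - t *\<^sub>R v)) v" L "S n" 0] line L by auto
      then have "\<bar>(\<phi> (x - S n *\<^sub>R v) - \<phi> x) / S n\<bar> \<le> L"
        using S(1) by (simp add: divide_simps)
      then have "norm (?q n x) \<le> L * B"
        using f(2)[of x] nonneg by (simp only: real_norm_def abs_mult) (intro mult_mono, auto)
      moreover have "?q n x = 0" if "x \<notin> cball 0 (r + c * norm v)"
        using out'[OF that c(1)] out'[OF that, of 0] c(2) by simp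
      ultimately show "norm (?q n x) \<le> L * B * indicator (cball 0 (r + c * norm v)) x"
        by (auto split: split_indicator)
    qed
  qed measurable
  moreover have "(\<integral>x. ?q n x \<partial>lborel) = ((\<integral>x. \<phi> (x - (0 + S n) *\<^sub>R v) * f x \<partial>lborel) -
      (\<integral>x. \<phi> (x - 0 *\<^sub>R v) * f x \<partial>lborel)) / S n" for n
  proof -
    have "?q n = (\<lambda>x. (\<phi> (x - S n *\<^sub>R v) * f x - \<phi> (x - 0 *\<^sub>R v) * f x) / S n)"
      by (auto simp: left_diff_distrib diff_divide_distrib)
    then show ?thesis
      using int[OF c(1)[of n]] int[of 0] c(2) by simp
  qed
  ultimately show "(\<lambda>n. ((\<integral>x. \<phi> (x - (0 + S n) *\<^sub>R v) * f x \<partial>lborel) -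
      (\<integral>x. \<phi> (x - 0 *\<^sub>R v) * f x \<partial>lborel)) / S n)
    \<longlonglongrightarrow> - (\<integral>x. frechet_derivative \<phi> (at x) v * f x \<partial>lborel)"
    by (simp only: mult_minus_left integral_minus)
qed

lemma has_derivative_integral_translate:
  assumes \<phi>: "test_function \<phi>" and f: "f \<in> borel_measurable borel" "\<And>x. \<bar>f x\<bar> \<le> B"
  shows "((\<lambda>t. \<integral>x. \<phi> (x - t *\<^sub>R v) * f x \<partial>lborel) has_real_derivative
      - (\<integral>x. frechet_derivative \<phi> (at (x - t *\<^sub>R v)) v * f x \<partial>lborel)) (at t)"
proof -
  let ?\<psi> = "\<lambda>x. \<phi> (x - t *\<^sub>R v)"
  have "\<phi> differentiable (at x)" for x
    using has_derivative_test_function[OF \<phi>] differentiableI by blast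
  then have "frechet_derivative ?\<psi> (at x) = frechet_derivative \<phi> (at (x - t *\<^sub>R v))" for x
    by (rule frechet_derivative_translate)
  with has_derivative_integral_translate_at_0[OF test_function_translate[OF \<phi>, where a = "t *\<^sub>R v"] f,
      where v = v]
  have "((\<lambda>s. \<integral>x. \<phi> (x - (s + t) *\<^sub>R v) * f x \<partial>lborel) has_real_derivative
      - (\<integral>x. frechet_derivative \<phi> (at (x - t *\<^sub>R v)) v * f x \<partial>lborel)) (at 0)"
    by (simp add: scaleR_add_left diff_diff_eq)
  then show ?thesis
    using DERIV_shift[of "\<lambda>t. \<integral>x. \<phi> (x - t *\<^sub>R v) * f x \<partial>lborel" _ 0 t] by simp
qed

section \<open>Essential points\<close>

text \<open>
  Almost every point is essential for a measurable function, by second countability alone, and a closed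
  condition that holds for almost every pair holds for every pair of essential points. This replaces
  Lebesgue's differentiation theorem.
\<close>

definition essential_points :: "('a::euclidean_space \<Rightarrow> 'b::metric_space) \<Rightarrow> 'a set" where
  "essential_points f = {x. \<forall>e>0. emeasure lborel (ball x e \<inter> f -` ball (f x) e) \<noteq> 0}"

text \<open>If \<open>x\<close> is not essential, there are basic open sets \<open>U\<close> around
  \<open>x\<close> and \<open>V\<close> around \<open>f x\<close> such that the part of
  \<open>U\<close> mapped into \<open>V\<close> is null. Only countably many such pairs exist, and
  their null sets cover all exceptional points.\<close>

lemma AE_essential_points:
  fixes f :: "'a::euclidean_space \<Rightarrow> 'b::{metric_space, second_countable_topology}"
  assumes f[measurable]: "f \<in> borel_measurable borel"
  shows "AE x in lborel. x \<in> essential_points f"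
proof -
  obtain A :: "'a set set" where A: "countable A" "\<And>X. X \<in> A \<Longrightarrow> open X"
    "\<And>S. open S \<Longrightarrow> \<exists>U. U \<subseteq> A \<and> S = \<Union>U"
    using univ_second_countable by blast
  obtain B :: "'b set set" where B: "countable B" "\<And>X. X \<in> B \<Longrightarrow> open X"
    "\<And>S. open S \<Longrightarrow> \<exists>U. U \<subseteq> B \<and> S = \<Union>U"
    using univ_second_countable by blast
  let ?I = "{(U, V) \<in> A \<times> B. emeasure lborel (U \<inter> f -` V) = 0}"
  have "(\<Union>(U, V)\<in>?I. U \<inter> f -` V) \<in> null_sets lborel"
  proof (rule null_sets_UN')
    show "countable ?I"
      by (rule countable_subset[OF _ countable_SIGMA[OF A(1) B(1)]]) auto
    fix i assume "i \<in> ?I"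
    then obtain U V where i: "i = (U, V)" "open U" "open V" "emeasure lborel (U \<inter> f -` V) = 0"
      using A(2) B(2) by auto
    have "U \<inter> f -` V \<in> sets borel"
      using measurable_sets[OF f, of V] i by auto
    with i show "(case i of (U, V) \<Rightarrow> U \<inter> f -` V) \<in> null_sets lborel"
      by (auto simp: null_sets_def)
  qed
  then show ?thesis
  proof (rule AE_I', intro subsetI)
    fix x assume "x \<in> {x \<in> space lborel. x \<notin> essential_points f}"
    then obtain e where e: "e > 0" "emeasure lborel (ball x e \<inter> f -` ball (f x) e) = 0"
      by (auto simp: essential_points_def)
    obtain U where U: "U \<in> A" "x \<in> U" "U \<subseteq> ball x e"
      using A(3)[of "ball x e"] e(1) by (metis Union_iff Union_upper centre_in_ball open_ball subset_iff)
    obtain V where V: "V \<in> B" "f x \<in> V" "V \<subseteq> ball (f x) e"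
      using B(3)[of "ball (f x) e"] e(1) by (metis Union_iff Union_upper centre_in_ball open_ball subset_iff)
    have "ball x e \<inter> f -` ball (f x) e \<in> sets borel"
      using measurable_sets[OF f, of "ball (f x) e"] by auto
    then have "emeasure lborel (U \<inter> f -` V) \<le> emeasure lborel (ball x e \<inter> f -` ball (f x) e)"
      using U V by (intro emeasure_mono) auto
    then have "emeasure lborel (U \<inter> f -` V) = 0" using e by simp
    with U V show "x \<in> (\<Union>(U, V)\<in>?I. U \<inter> f -` V)" by auto
  qed
qed

lemma dist_Pair_le: "dist (a, b) (c, d) \<le> dist a c + dist b d"
  unfolding dist_Pair_Pair by (rule sqrt_sum_squares_le_sum) auto

text \<open>Were \<open>F\<close> positive at the given quadruple, it would stay positive for nearby
  points with nearby values of \<open>f\<close>. Essentiality makes these pairs contain a product of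
  two sets of positive measure, against \<open>ae\<close>.\<close>

lemma essential_points_le:
  fixes f :: "'a::euclidean_space \<Rightarrow> 'b::{metric_space, second_countable_topology}"
    and F :: "'a \<Rightarrow> 'a \<Rightarrow> 'b \<Rightarrow> 'b \<Rightarrow> real"
  assumes f[measurable]: "f \<in> borel_measurable borel"
    and F: "continuous_on UNIV (\<lambda>(x, y, u, v). F x y u v)"
    and ae: "AE z in lborel \<Otimes>\<^sub>M lborel. fst z \<in> U \<longrightarrow> snd z \<in> U \<longrightarrow>
      F (fst z) (snd z) (f (fst z)) (f (snd z)) \<le> 0"
    and U: "open U" "x \<in> U" "y \<in> U"
    and xy: "x \<in> essential_points f" "y \<in> essential_points f"
  shows "F x y (f x) (f y) \<le> 0"
proof (rule ccontr)
  assume pos: "\<not> ?thesis"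
  let ?F = "\<lambda>(x, y, u, v). F x y u v"
  have "open (?F -` {0<..})"
    using F by (simp add: continuous_on_open_vimage)
  then have "open (?F -` {0<..} \<inter> U \<times> U \<times> UNIV)"
    using U by (intro open_Int open_Times) auto
  moreover have "(x, y, f x, f y) \<in> ?F -` {0<..} \<inter> U \<times> U \<times> UNIV"
    using U pos by auto
  ultimately obtain e where e: "e > 0" "ball (x, y, f x, f y) e \<subseteq> ?F -` {0<..} \<inter> U \<times> U \<times> UNIV"
    by (meson openE)
  \<comment> \<open>The radius is \<open>e/4\<close> because the distance between quadruples is at
    most the sum of four coordinate distances.\<close>
  let ?A = "ball x (e/4) \<inter> f -` ball (f x) (e/4)" and ?B = "ball y (e/4) \<inter> f -` ball (f y) (e/4)"
  have sets: "?A \<in> sets lborel" "?B \<in> sets lborel"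
    using measurable_sets[OF f, of "ball (f x) (e/4)"] measurable_sets[OF f, of "ball (f y) (e/4)"]
    by auto
  have bad: "0 < F x' y' (f x') (f y') \<and> x' \<in> U \<and> y' \<in> U" if "x' \<in> ?A" "y' \<in> ?B" for x' y'
  proof -
    have "dist (x, y, f x, f y) (x', y', f x', f y') \<le>
        dist x x' + (dist y y' + (dist (f x) (f x') + dist (f y) (f y')))"
      by (meson add_left_mono dist_Pair_le order_trans)
    also have "\<dots> < e"
      using that by auto
    finally show ?thesis
      using e(2) by auto
  qed
  have "AE z in lborel \<Otimes>\<^sub>M lborel. z \<notin> ?A \<times> ?B"
    using ae by (rule eventually_mono) (use bad in force)
  then have "emeasure (lborel \<Otimes>\<^sub>M lborel) (?A \<times> ?B) = 0"
    using sets by (subst (asm) AE_iff_measurable[OF _ refl]) (auto simp: space_pair_measure)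
  then have "emeasure lborel ?A * emeasure lborel ?B = 0"
    using sets by (simp add: lborel.emeasure_pair_measure_Times)
  with xy e(1) show False
    unfolding essential_points_def by (auto dest!: spec[of _ "e/4"])
qed

text \<open>Fubini in the coordinates \<open>x\<close> and \<open>v = y - x\<close>. Measurability
  of the set of good pairs permits exchanging the order of the two quantifiers.\<close>

lemma AE_pair_translate:
  fixes P :: "'a::euclidean_space \<Rightarrow> 'a \<Rightarrow> bool"
  assumes P: "{z. P (fst z) (snd z)} \<in> sets (borel \<Otimes>\<^sub>M borel)"
    and ae: "\<And>v. AE x in lborel. P x (x + v)"
  shows "AE z in lborel \<Otimes>\<^sub>M lborel. P (fst z) (snd z)"
proof -
  have "(\<lambda>z :: 'a \<times> 'a. (fst z, fst z + snd z)) \<in> lborel \<Otimes>\<^sub>M lborel \<rightarrow>\<^sub>M borel \<Otimes>\<^sub>M borel"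
    by measurable
  from measurable_sets[OF this P]
  have "{z \<in> space (lborel \<Otimes>\<^sub>M lborel). P (fst z) (fst z + snd z)} \<in> sets (lborel \<Otimes>\<^sub>M lborel)"
    by (simp add: vimage_def space_pair_measure)
  then have "AE x in lborel. AE v in lborel. P x (x + v)"
    using lborel_pair.AE_commute[of "\<lambda>x v. P x (x + v)"] ae by simp
  moreover have "AE y in lborel. P x y" if "AE v in lborel. P x (x + v)" for x
  proof -
    have "Pair x \<in> borel \<rightarrow>\<^sub>M borel \<Otimes>\<^sub>M borel" by measurable
    from measurable_sets[OF this P] have "{y \<in> space borel. P x y} \<in> sets borel"
      by (simp add: vimage_def)
    with that have "AE y in distr lborel borel ((+) x). P x y"
      by (subst AE_distr_iff) auto
    then show ?thesis unfolding lborel_distr_plus .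
  qed
  ultimately have "AE x in lborel. AE y in lborel. P x y"
    by (auto elim: eventually_mono)
  then show ?thesis
    using P by (intro lborel_pair.AE_pair_measure)
      (auto simp: space_pair_measure sets_pair_measure_cong[OF sets_lborel sets_lborel])
qed

text \<open>Let \<open>\<mu>\<close> and \<open>\<eta>\<close> have the positive and negative parts
  of \<open>W\<close> as densities, so that \<open>\<eta> \<le> \<mu>\<close> on boxes. Cover the
  set \<open>P\<close> where \<open>W < 0\<close> by nonoverlapping boxes inside an open
  \<open>T\<close> only slightly larger than \<open>P\<close>. Since \<open>\<mu> P = 0\<close>,
  summing over the boxes bounds \<open>\<eta> P\<close> by \<open>\<mu> (T - P)\<close>, which is
  arbitrarily small.\<close>

lemma AE_nonneg_if_box_integrals_nonneg:
  fixes W :: "'a::euclidean_space \<Rightarrow> real"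
  assumes W[measurable]: "W \<in> borel_measurable borel" and bound: "\<And>x. \<bar>W x\<bar> \<le> M"
    and box: "\<And>c d. cbox c d \<subseteq> cbox a b \<Longrightarrow> 0 \<le> (\<integral>x. indicator (box c d) x * W x \<partial>lborel)"
  shows "AE x in lborel. x \<in> cbox a b \<longrightarrow> 0 \<le> W x"
proof (cases "box a b = {}")
  \<comment> \<open>The covering lemma asks for nonempty interior; a degenerate box is null.\<close>
  case True
  then have "emeasure lborel (cbox a b) = 0"
    by (auto simp: emeasure_lborel_cbox_eq box_eq_empty inner_diff_left prod_nonneg intro!: antisym)
  then have "cbox a b \<in> null_sets lborel" by (simp add: null_sets_def)
  then show ?thesis by (rule AE_I') auto
next
  case False
  define \<mu> where "\<mu> = density lborel (\<lambda>x. ennreal (W x))"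
  define \<eta> where "\<eta> = density lborel (\<lambda>x. ennreal (- W x))"
  have M: "0 \<le> M" using bound[of 0] by linarith
  have \<mu>: "emeasure \<mu> A = (\<integral>\<^sup>+x\<in>A. ennreal (W x) \<partial>lborel)" if "A \<in> sets borel" for A
    unfolding \<mu>_def using that by (subst emeasure_density) auto
  have \<eta>: "emeasure \<eta> A = (\<integral>\<^sup>+x\<in>A. ennreal (- W x) \<partial>lborel)" if "A \<in> sets borel" for A
    unfolding \<eta>_def using that by (subst emeasure_density) auto
  have box': "emeasure \<eta> (box c d) \<le> emeasure \<mu> (box c d)" if "cbox c d \<subseteq> cbox a b" for c d
  proof -
    have int: "integrable lborel (\<lambda>x. indicator (box c d) x * g x)"
      if [measurable]: "g \<in> borel_measurable borel" and g: "\<And>x. \<bar>g x\<bar> \<le> M" for g :: "'a \<Rightarrow> real"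
    proof -
      obtain r where r: "box c d \<subseteq> cball 0 r"
        using bounded_box[of c d] unfolding bounded_iff by (metis mem_cball_0 subsetI)
      show ?thesis
        by (rule integrable_bounded_support[where C = M and a = 0 and r = r])
           (use g M r in \<open>auto split: split_indicator\<close>)
    qed
    have fin: "(\<integral>\<^sup>+x\<in>box c d. ennreal (g x) \<partial>lborel) =
        ennreal (\<integral>x. indicator (box c d) x * max 0 (g x) \<partial>lborel)"
      if [measurable]: "g \<in> borel_measurable borel" and g: "\<And>x. \<bar>g x\<bar> \<le> M" for g :: "'a \<Rightarrow> real"
    proof -
      have "(\<integral>\<^sup>+x. ennreal (indicator (box c d) x * max 0 (g x)) \<partial>lborel) =
          ennreal (\<integral>x. indicator (box c d) x * max 0 (g x) \<partial>lborel)"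
        by (intro nn_integral_eq_integral int AE_I2) (use g M in \<open>auto simp: max_def abs_le_iff\<close>)
      moreover have "(\<integral>\<^sup>+x. ennreal (indicator (box c d) x * max 0 (g x)) \<partial>lborel) =
          (\<integral>\<^sup>+x\<in>box c d. ennreal (g x) \<partial>lborel)"
        by (intro nn_integral_cong) (auto split: split_indicator simp: max_def ennreal_neg)
      ultimately show ?thesis by simp
    qed
    have "(\<integral>x. indicator (box c d) x * max 0 (W x) \<partial>lborel) -
        (\<integral>x. indicator (box c d) x * max 0 (- W x) \<partial>lborel) =
        (\<integral>x. indicator (box c d) x * W x \<partial>lborel)"
      using bound M
      by (subst Bochner_Integration.integral_diff[symmetric])
         (auto intro!: int Bochner_Integration.integral_cong simp: max_def abs_le_iff split: split_indicator)
    then have "(\<integral>x. indicator (box c d) x * max 0 (- W x) \<partial>lborel) \<le>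
        (\<integral>x. indicator (box c d) x * max 0 (W x) \<partial>lborel)"
      using box[OF that] by simp
    then show ?thesis
      using fin[of W] fin[of "\<lambda>x. - W x"] bound by (simp add: \<mu> \<eta> ennreal_leI)
  qed
  define P where "P = {x. W x < 0} \<inter> cbox a b"
  have [measurable]: "P \<in> sets borel" unfolding P_def by measurable
  have "emeasure \<eta> P \<le> 0 + ennreal (M * e)" if e: "e > 0" for e
  proof -
    obtain T where T: "open T" "P \<subseteq> T" "emeasure lebesgue (T - P) < ennreal e"
      by (rule sets_lebesgue_outer_open[of P e]) (use e in auto)
    have T': "emeasure lborel (T - P) \<le> ennreal e"
      using T(1,3) by (subst (asm) emeasure_completion) (auto simp: main_part_sets)
    \<comment> \<open>The gauge sends each point of \<open>T\<close> to \<open>T\<close>. Each cell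
      is controlled by a point of \<open>P\<close>, hence of \<open>T\<close>, and so stays inside
      \<open>T\<close>; the value \<open>UNIV\<close> only completes the gauge off
      \<open>T\<close>.\<close>
    obtain \<D> where D: "countable \<D>" "\<Union>\<D> \<subseteq> cbox a b"
      "\<And>K. K \<in> \<D> \<Longrightarrow> interior K \<noteq> {} \<and> (\<exists>c d. K = cbox c d)"
      "pairwise (\<lambda>A B. interior A \<inter> interior B = {}) \<D>"
      "\<And>K. K \<in> \<D> \<Longrightarrow> \<exists>x \<in> P \<inter> K. K \<subseteq> (if x \<in> T then T else UNIV)"
      "P \<subseteq> \<Union>\<D>"
      by (rule covering_lemma[of P a b "\<lambda>x. if x \<in> T then T else UNIV"])
         (use False T(1) in \<open>auto simp: P_def gauge_def\<close>)
    have KT: "K \<subseteq> T" if "K \<in> \<D>" for K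
      using D(5)[OF that] T(2) by (auto split: if_splits)
    have [measurable]: "K \<in> sets borel" if "K \<in> \<D>" for K
      using D(3)[OF that] by auto
    have UD[measurable]: "(\<Union>K\<in>\<D>. interior K) \<in> sets borel"
      by (intro borel_open) auto
    \<comment> \<open>Cells have disjoint interiors but may share boundaries. Dropping the null
      boundaries gives a disjoint family that still covers almost all of \<open>P\<close>, so
      countable additivity applies.\<close>
    have "(\<Union>K\<in>\<D>. K - interior K) \<in> null_sets lborel"
    proof (intro null_sets_UN' D(1))
      fix K assume "K \<in> \<D>"
      then obtain c d where K: "K = cbox c d" using D(3) by blast
      show "K - interior K \<in> null_sets lborel"
        unfolding K interior_cbox null_sets_def
        by (auto simp: emeasure_Diff[OF _ _ _ box_subset_cbox] emeasure_lborel_box_eq emeasure_lborel_cbox_eq emeasure_lborel_box_finite)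
    qed
    then have "AE x in lborel. x \<notin> (\<Union>K\<in>\<D>. K - interior K)"
      by (rule AE_not_in)
    then have "AE x in \<eta>. x \<in> P \<longrightarrow> x \<in> (\<Union>K\<in>\<D>. interior K)"
      unfolding \<eta>_def using D(6) by (subst AE_density) (auto elim!: eventually_mono)
    then have "emeasure \<eta> P \<le> emeasure \<eta> (\<Union>K\<in>\<D>. interior K)"
      by (intro emeasure_mono_AE) (auto simp: \<eta>_def)
    also have "\<dots> = (\<integral>\<^sup>+K. emeasure \<eta> (interior K) \<partial>count_space \<D>)"
      using D(1,4)
      by (intro emeasure_UN_countable)
         (auto simp: \<eta>_def disjoint_family_on_def pairwise_def intro!: borel_open)
    also have "\<dots> \<le> (\<integral>\<^sup>+K. emeasure \<mu> (interior K) \<partial>count_space \<D>)"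
    proof (intro nn_integral_mono)
      fix K assume "K \<in> space (count_space \<D>)"
      then have "K \<in> \<D>" by simp
      then obtain c d where K: "K = cbox c d" using D(3) by blast
      have "cbox c d \<subseteq> cbox a b" using D(2) \<open>K \<in> \<D>\<close> K by blast
      from box'[OF this] show "emeasure \<eta> (interior K) \<le> emeasure \<mu> (interior K)"
        by (simp add: K interior_cbox)
    qed
    also have "\<dots> = emeasure \<mu> (\<Union>K\<in>\<D>. interior K)"
      using D(1,4)
      by (intro emeasure_UN_countable[symmetric])
         (auto simp: \<mu>_def disjoint_family_on_def pairwise_def intro!: borel_open)
    also have "\<dots> \<le> emeasure \<mu> (P \<union> (T - P))"
      using KT interior_subset T(1) by (intro emeasure_mono) (auto simp: \<mu>_def)
    also have "\<dots> \<le> emeasure \<mu> P + emeasure \<mu> (T - P)"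
      using T(1) by (intro emeasure_subadditive) (auto simp: \<mu>_def)
    also have "emeasure \<mu> P = 0"
    proof -
      have "emeasure \<mu> P = (\<integral>\<^sup>+x. 0 \<partial>(lborel :: 'a measure))"
        unfolding \<mu>[OF \<open>P \<in> sets borel\<close>]
        by (intro nn_integral_cong) (auto simp: P_def ennreal_neg split: split_indicator)
      then show ?thesis by simp
    qed
    also have "emeasure \<mu> (T - P) \<le> (\<integral>\<^sup>+x\<in>T - P. ennreal M \<partial>lborel)"
      using T(1)
      by (subst \<mu>) (auto intro!: nn_integral_mono mult_right_mono ennreal_leI abs_le_D1[OF bound])
    also have "\<dots> = ennreal M * emeasure lborel (T - P)"
      using T(1) by (simp add: nn_integral_cmult_indicator)
    also have "\<dots> \<le> ennreal (M * e)"
      using T' M e by (simp add: ennreal_mult mult_left_mono)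
    finally show ?thesis by simp
  qed
  have "emeasure \<eta> P = 0"
  proof (rule antisym)
    show "emeasure \<eta> P \<le> 0"
    proof (rule ennreal_le_epsilon)
      fix e :: real assume "e > 0"
      \<comment> \<open>The denominator \<open>M + 1\<close> also handles
        \<open>M = 0\<close>.\<close>
      then have "emeasure \<eta> P \<le> 0 + ennreal (M * (e / (M + 1)))"
        using M by (intro \<open>\<And>e. e > 0 \<Longrightarrow> emeasure \<eta> P \<le> 0 + ennreal (M * e)\<close>) auto
      also have "M * (e / (M + 1)) \<le> e"
        using M \<open>e > 0\<close> by (simp add: field_simps)
      finally show "emeasure \<eta> P \<le> 0 + ennreal e"
        by (simp add: ennreal_leI)
    qed
  qed simp
  then have "AE x in lborel. ennreal (- W x) * indicator P x = 0"
    unfolding \<eta>[OF \<open>P \<in> sets borel\<close>] by (subst (asm) nn_integral_0_iff_AE) auto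
  then show ?thesis
  proof (rule eventually_mono, intro impI)
    fix x assume *: "ennreal (- W x) * indicator P x = 0" "x \<in> cbox a b"
    show "0 \<le> W x"
    proof (rule ccontr)
      assume "\<not> 0 \<le> W x"
      with * show False by (simp add: P_def ennreal_eq_0_iff)
    qed
  qed
qed

section \<open>One-sided bounds tested against smooth functions\<close>

lemma integral_lborel_translate:
  fixes f :: "'a::euclidean_space \<Rightarrow> real"
  assumes [measurable]: "f \<in> borel_measurable borel"
  shows "(\<integral>x. f (x + c) \<partial>lborel) = (\<integral>x. f x \<partial>lborel)"
proof -
  have "(\<integral>x. f x \<partial>lborel) = (\<integral>x. f x \<partial>distr lborel borel ((+) c))"
    unfolding lborel_distr_plus ..
  also have "\<dots> = (\<integral>x. f (c + x) \<partial>lborel)"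
    by (rule integral_distr) auto
  finally show ?thesis by (simp add: add.commute)
qed

context
  fixes \<beta> :: "'a::euclidean_space \<Rightarrow> 'a" and M :: real
  assumes \<beta>[measurable]: "\<beta> \<in> borel_measurable borel" and M: "\<And>x. norm (\<beta> x) \<le> M"
begin

lemma inner_field_bound: "\<bar>\<beta> x \<bullet> w\<bar> \<le> M * norm w"
  using Cauchy_Schwarz_ineq2[of "\<beta> x" w] mult_right_mono[OF M norm_ge_zero, of x w] by linarith

lemma integrable_test_function_mult:
  assumes \<phi>: "test_function \<phi>" and f[measurable]: "f \<in> borel_measurable borel"
    and B: "\<And>x. \<bar>f x\<bar> \<le> B"
  shows "integrable lborel (\<lambda>x. \<phi> x * f x)"
proof -
  obtain L where L: "\<And>x. \<bar>\<phi> x\<bar> \<le> L" using bounded_test_function[OF \<phi>] by blast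
  obtain r where r: "closure {x. \<phi> x \<noteq> 0} \<subseteq> cball 0 r"
    using bounded_support_test_function[OF \<phi>] .
  note [measurable] = borel_measurable_continuous_onI[OF continuous_test_function[OF \<phi>]]
  show ?thesis
  proof (rule integrable_bounded_support)
    show "norm (\<phi> x * f x) \<le> L * B" for x
      unfolding real_norm_def abs_mult using L[of x] B[of x] by (intro mult_mono) auto
    show "\<phi> x * f x = 0" if "x \<notin> cball 0 r" for x
    proof -
      have "x \<notin> closure {x. \<phi> x \<noteq> 0}" using r that by blast
      from eq_0_outside_support[OF this] show ?thesis by simp
    qed
  qed measurable
qed

lemma integrable_derivative_test_function_mult:
  assumes \<phi>: "test_function \<phi>" and f[measurable]: "f \<in> borel_measurable borel"
    and B: "\<And>x. \<bar>f x\<bar> \<le> B"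
  shows "integrable lborel (\<lambda>x. frechet_derivative \<phi> (at x) v * f x)"
proof -
  obtain L where L: "\<And>x. \<bar>frechet_derivative \<phi> (at x) v\<bar> \<le> L"
    using bounded_derivative_test_function[OF \<phi>, where v = v] by blast
  obtain r where r: "closure {x. \<phi> x \<noteq> 0} \<subseteq> cball 0 r"
    using bounded_support_test_function[OF \<phi>] .
  note [measurable] = borel_measurable_continuous_onI[OF continuous_derivative_test_function[OF \<phi>]]
  show ?thesis
  proof (rule integrable_bounded_support)
    show "norm (frechet_derivative \<phi> (at x) v * f x) \<le> L * B" for x
      unfolding real_norm_def abs_mult using L[of x] B[of x] by (intro mult_mono) auto
    show "frechet_derivative \<phi> (at x) v * f x = 0" if "x \<notin> cball 0 r" for x
    proof -
      have "x \<notin> closure {x. \<phi> x \<noteq> 0}" using r that by blast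
      from derivative_test_function_zero[OF \<phi> this] show ?thesis by simp
    qed
  qed measurable
qed

lemma integral_translate_diff:
  assumes \<phi>: "test_function \<phi>"
  shows "(\<integral>x. \<phi> (x - u) * (\<beta> x \<bullet> w) \<partial>lborel) - (\<integral>x. \<phi> x * (\<beta> x \<bullet> w) \<partial>lborel) =
    (\<integral>x. \<phi> x * ((\<beta> (x + u) - \<beta> x) \<bullet> w) \<partial>lborel)"
proof -
  note [measurable] = borel_measurable_continuous_onI[OF continuous_test_function[OF \<phi>]]
  have "(\<integral>x. \<phi> (x - u) * (\<beta> x \<bullet> w) \<partial>lborel) = (\<integral>x. \<phi> x * (\<beta> (x + u) \<bullet> w) \<partial>lborel)"
    using integral_lborel_translate[of "\<lambda>x. \<phi> (x - u) * (\<beta> x \<bullet> w)" u] by simp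
  moreover have "integrable lborel (\<lambda>x. \<phi> x * (\<beta> (x + u) \<bullet> w))" "integrable lborel (\<lambda>x. \<phi> x * (\<beta> x \<bullet> w))"
    using inner_field_bound by (intro integrable_test_function_mult[OF \<phi>, where B = "M * norm w"]; simp)+
  ultimately show ?thesis
    by (simp add: inner_diff_left right_diff_distrib)
qed

text \<open>Formally this is \<open>(D\<beta> w) \<bullet> w \<le> \<nu> * (norm w)^2\<close> tested
  against \<open>\<phi>\<close>. The left side is the derivative at 0 of the integral of
  \<open>\<beta> x \<bullet> w\<close> against \<open>\<phi>\<close> shifted by \<open>t w\<close>.
  The condition for the increment \<open>u = t w\<close> carries a factor \<open>t^2\<close> on the
  right, which bounds the difference quotients uniformly in \<open>t\<close>.\<close>

lemma weak_one_sided_upper: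
  assumes \<phi>: "test_function \<phi>" "\<And>x. 0 \<le> \<phi> x" "\<And>x. \<phi> x \<noteq> 0 \<Longrightarrow> norm x \<le> r" and "r < \<rho>"
    and upper: "\<And>u. AE x in lborel. norm x < \<rho> \<longrightarrow> norm (x + u) < \<rho> \<longrightarrow>
      (\<beta> (x + u) - \<beta> x) \<bullet> u \<le> \<nu> * (norm u)\<^sup>2"
  shows "- (\<integral>x. frechet_derivative \<phi> (at x) w * (\<beta> x \<bullet> w) \<partial>lborel) \<le>
    \<nu> * (norm w)\<^sup>2 * (\<integral>x. \<phi> x \<partial>lborel)" (is "?d \<le> ?c")
proof -
  let ?g = "\<lambda>t. \<integral>x. \<phi> (x - t *\<^sub>R w) * (\<beta> x \<bullet> w) \<partial>lborel"
  have "(?g has_real_derivative ?d) (at 0)"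
    using inner_field_bound
    by (intro has_derivative_integral_translate_at_0[OF \<phi>(1)]) auto
  then have "((\<lambda>h. (?g h - ?g 0) / h) \<longlongrightarrow> ?d) (at_right 0)"
    unfolding DERIV_def using filterlim_mono[OF _ order_refl at_within_le_at] by auto
  moreover have "eventually (\<lambda>h. (?g h - ?g 0) / h \<le> ?c) (at_right 0)"
  proof -
    \<comment> \<open>Shifts below this threshold keep \<open>x + t w\<close> in the ball of radius
      \<open>\<rho>\<close> for all \<open>x\<close> in the support; the summand 1 allows
      \<open>w = 0\<close>.\<close>
    have "(\<rho> - r) / (norm w + 1) > 0" using \<open>r < \<rho>\<close> by (simp add: add_nonneg_pos)
    then have "eventually (\<lambda>h. h \<in> {0<..<(\<rho> - r) / (norm w + 1)}) (at_right 0)"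
      by (rule eventually_at_right_real)
    then show ?thesis
    proof (rule eventually_mono)
      fix t assume t: "t \<in> {0<..<(\<rho> - r) / (norm w + 1)}"
      then have "t * (norm w + 1) < \<rho> - r" "0 < t"
        by (auto simp: pos_less_divide_eq add_nonneg_pos)
      then have tw: "t * norm w < \<rho> - r" by (simp add: algebra_simps)
      have "?g t - ?g 0 = (\<integral>x. \<phi> x * ((\<beta> (x + t *\<^sub>R w) - \<beta> x) \<bullet> w) \<partial>lborel)"
        using integral_translate_diff[OF \<phi>(1), of "t *\<^sub>R w" w] by simp
      also have "\<dots> \<le> (\<integral>x. \<phi> x * (\<nu> * t * (norm w)\<^sup>2) \<partial>lborel)"
      proof (rule integral_mono_AE)
        have "\<bar>(\<beta> (x + t *\<^sub>R w) - \<beta> x) \<bullet> w\<bar> \<le> M * norm w + M * norm w" for x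
          using inner_field_bound[of "x + t *\<^sub>R w" w] inner_field_bound[of x w]
          by (simp add: inner_diff_left)
        then show "integrable lborel (\<lambda>x. \<phi> x * ((\<beta> (x + t *\<^sub>R w) - \<beta> x) \<bullet> w))"
          by (intro integrable_test_function_mult[OF \<phi>(1)]) auto
        show "integrable lborel (\<lambda>x. \<phi> x * (\<nu> * t * (norm w)\<^sup>2))"
          by (intro integrable_test_function_mult[OF \<phi>(1)]) auto
        show "AE x in lborel. \<phi> x * ((\<beta> (x + t *\<^sub>R w) - \<beta> x) \<bullet> w) \<le> \<phi> x * (\<nu> * t * (norm w)\<^sup>2)"
          using upper[of "t *\<^sub>R w"]
        proof (rule eventually_mono)
          fix x assume *: "norm x < \<rho> \<longrightarrow> norm (x + t *\<^sub>R w) < \<rho> \<longrightarrow>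
            (\<beta> (x + t *\<^sub>R w) - \<beta> x) \<bullet> (t *\<^sub>R w) \<le> \<nu> * (norm (t *\<^sub>R w))\<^sup>2"
          show "\<phi> x * ((\<beta> (x + t *\<^sub>R w) - \<beta> x) \<bullet> w) \<le> \<phi> x * (\<nu> * t * (norm w)\<^sup>2)"
          proof (cases "\<phi> x = 0")
            case False
            then have "norm x \<le> r" by (rule \<phi>)
            moreover have "norm (x + t *\<^sub>R w) \<le> norm x + t * norm w"
              using norm_triangle_ineq[of x "t *\<^sub>R w"] \<open>0 < t\<close> by simp
            ultimately have "t * ((\<beta> (x + t *\<^sub>R w) - \<beta> x) \<bullet> w) \<le> t * (\<nu> * t * (norm w)\<^sup>2)"
              using * tw \<open>r < \<rho>\<close> \<open>0 < t\<close> by (simp add: power2_eq_square mult_ac)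
            then show ?thesis
              using \<open>0 < t\<close> \<phi>(2) by (intro mult_left_mono) auto
          qed simp
        qed
      qed
      also have "\<dots> = t * ?c"
        by simp
      finally show "(?g t - ?g 0) / t \<le> ?c"
        using \<open>0 < t\<close> by (simp add: divide_simps mult.commute)
    qed
  qed
  ultimately show ?thesis
    by (intro tendsto_upperbound) auto
qed

lemma weak_one_sided_lower:
  assumes \<phi>: "test_function \<phi>" "\<And>x. 0 \<le> \<phi> x" "\<And>x. \<phi> x \<noteq> 0 \<Longrightarrow> norm x \<le> r" and "r < \<rho>"
    and upper: "\<And>u. AE x in lborel. norm x < \<rho> \<longrightarrow> norm (x + u) < \<rho> \<longrightarrow>
      (\<beta> (x + u) - \<beta> x) \<bullet> u \<le> \<nu> * (norm u)\<^sup>2"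
    and "0 \<le> \<nu>"
    and div: "(\<integral>x. frechet_derivative \<phi> (at x) (\<beta> x) \<partial>lborel) \<le> \<mu> * (\<integral>x. \<phi> x \<partial>lborel)"
  shows "(\<integral>x. frechet_derivative \<phi> (at x) v * (\<beta> x \<bullet> v) \<partial>lborel) \<le>
    (\<mu> + \<nu> * DIM('a)) * (norm v)\<^sup>2 * (\<integral>x. \<phi> x \<partial>lborel)"
proof (cases "v = 0")
  case False
  \<comment> \<open>In an orthonormal basis containing the direction of \<open>v\<close>, the divergence bounds the trace from
    below and the one-sided condition bounds every other diagonal entry from above.\<close>
  define w where "w = v /\<^sub>R norm v"
  have v: "v = norm v *\<^sub>R w" and "norm w = 1" using False by (auto simp: w_def)
  let ?D = "\<lambda>x. frechet_derivative \<phi> (at x)"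
  let ?I = "\<integral>x. \<phi> x \<partial>lborel"
  have I: "0 \<le> ?I" using \<phi>(2) by simp
  obtain S where S: "w \<in> S" "pairwise orthogonal S" "\<And>x. x \<in> S \<Longrightarrow> norm x = 1"
    "independent S" "card S = DIM('a)" "span S = UNIV"
    using vector_in_orthonormal_basis[OF \<open>norm w = 1\<close>] by metis
  have "finite S" using S(4) finiteI_independent by blast
  have int: "integrable lborel (\<lambda>x. ?D x s * (\<beta> x \<bullet> s))" for s
    using inner_field_bound by (intro integrable_derivative_test_function_mult[OF \<phi>(1)]) auto
  have "?D x (\<beta> x) = (\<Sum>s\<in>S. ?D x s * (\<beta> x \<bullet> s))" for x
  proof -
    have "\<beta> x = (\<Sum>s\<in>S. (\<beta> x \<bullet> s) *\<^sub>R s)"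
      using orthonormal_basis_expand[OF S(2,3) _ \<open>finite S\<close>, of "\<beta> x"] S(6) by simp
    then have "?D x (\<beta> x) = ?D x (\<Sum>s\<in>S. (\<beta> x \<bullet> s) *\<^sub>R s)" by simp
    also have "\<dots> = (\<Sum>s\<in>S. ?D x s * (\<beta> x \<bullet> s))"
      using linear_derivative_test_function[OF \<phi>(1), of x]
      by (simp add: linear_sum linear_scale mult.commute)
    finally show ?thesis .
  qed
  \<comment> \<open>\<open>div\<close> says weakly that the divergence is at least
    \<open>-\<mu>\<close>; integration by parts flips the sign, so the trace appears here with an
    upper bound.\<close>
  then have "(\<Sum>s\<in>S. \<integral>x. ?D x s * (\<beta> x \<bullet> s) \<partial>lborel) \<le> \<mu> * ?I"
    using div int by (simp add: Bochner_Integration.integral_sum)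
  then have "(\<integral>x. ?D x w * (\<beta> x \<bullet> w) \<partial>lborel) \<le>
      \<mu> * ?I + (\<Sum>s\<in>S - {w}. - (\<integral>x. ?D x s * (\<beta> x \<bullet> s) \<partial>lborel))"
    using \<open>finite S\<close> S(1) by (simp add: sum.remove[of S w] sum_negf)
  also have "\<dots> \<le> \<mu> * ?I + (\<Sum>s\<in>S - {w}. \<nu> * ?I)"
  proof (intro add_left_mono sum_mono)
    fix s assume "s \<in> S - {w}"
    then have "norm s = 1" using S(3) by auto
    with weak_one_sided_upper[OF \<phi> \<open>r < \<rho>\<close> upper, of s]
    show "- (\<integral>x. ?D x s * (\<beta> x \<bullet> s) \<partial>lborel) \<le> \<nu> * ?I" by simp
  qed
  also have "\<dots> = \<mu> * ?I + real (DIM('a) - 1) * (\<nu> * ?I)"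
    using S(1,5) \<open>finite S\<close> by simp
  \<comment> \<open>Rounding \<open>DIM('a) - 1\<close> up costs nothing of substance and gives a
    constant without subtraction.\<close>
  also have "\<dots> \<le> \<mu> * ?I + real DIM('a) * (\<nu> * ?I)"
    using I \<open>0 \<le> \<nu>\<close> by (intro add_left_mono mult_right_mono) auto
  finally have "(\<integral>x. ?D x w * (\<beta> x \<bullet> w) \<partial>lborel) \<le> (\<mu> + \<nu> * DIM('a)) * ?I"
    by (simp add: algebra_simps)
  then have "(norm v)\<^sup>2 * (\<integral>x. ?D x w * (\<beta> x \<bullet> w) \<partial>lborel) \<le> (norm v)\<^sup>2 * ((\<mu> + \<nu> * DIM('a)) * ?I)"
    by (intro mult_left_mono) auto
  moreover have "?D x v * (\<beta> x \<bullet> v) = (norm v)\<^sup>2 * (?D x w * (\<beta> x \<bullet> w))" for x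
    using linear_derivative_test_function[OF \<phi>(1), of x]
    by (subst (1 2) v) (simp add: linear_scale power2_eq_square)
  then have "(\<integral>x. ?D x v * (\<beta> x \<bullet> v) \<partial>lborel) = (norm v)\<^sup>2 * (\<integral>x. ?D x w * (\<beta> x \<bullet> w) \<partial>lborel)"
    by simp
  ultimately show ?thesis
    by (simp add: mult.assoc mult.left_commute)
qed (simp add: linear_0[OF linear_derivative_test_function[OF \<phi>(1)]])

text \<open>Integrates the infinitesimal bound along the segment from \<open>x\<close> to
  \<open>x + v\<close>: the function \<open>k\<close> below has nonnegative derivative because each
  translate of \<open>\<phi>\<close> by \<open>t v\<close> is again an admissible test function. Its
  support lies in radius \<open>r + norm v\<close>, whence the condition on \<open>\<rho>\<close>.
  Comparing \<open>k 0\<close> with \<open>k 1\<close> yields a finite difference of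
  \<open>\<beta>\<close>.\<close>

lemma integrated_one_sided_lower:
  assumes \<phi>: "test_function \<phi>" "\<And>x. 0 \<le> \<phi> x" "\<And>x. \<phi> x \<noteq> 0 \<Longrightarrow> norm x \<le> r"
    and "r + norm v < \<rho>"
    and upper: "\<And>u. AE x in lborel. norm x < \<rho> \<longrightarrow> norm (x + u) < \<rho> \<longrightarrow>
      (\<beta> (x + u) - \<beta> x) \<bullet> u \<le> \<nu> * (norm u)\<^sup>2"
    and "0 \<le> \<nu>"
    and div: "\<And>\<phi>. test_function \<phi> \<Longrightarrow> (\<And>x. 0 \<le> \<phi> x) \<Longrightarrow>
      (\<integral>x. frechet_derivative \<phi> (at x) (\<beta> x) \<partial>lborel) \<le> \<mu> * (\<integral>x. \<phi> x \<partial>lborel)"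
  shows "0 \<le> (\<integral>x. \<phi> x * ((\<beta> (x + v) - \<beta> x) \<bullet> v + (\<mu> + \<nu> * DIM('a)) * (norm v)\<^sup>2) \<partial>lborel)"
proof -
  let ?g = "\<lambda>t. \<integral>x. \<phi> (x - t *\<^sub>R v) * (\<beta> x \<bullet> v) \<partial>lborel"
  let ?I = "\<integral>x. \<phi> x \<partial>lborel"
  let ?c = "(\<mu> + \<nu> * DIM('a)) * (norm v)\<^sup>2 * ?I"
  note [measurable] = borel_measurable_continuous_onI[OF continuous_test_function[OF \<phi>(1)]]
  define k where "k t = ?g t + t * ?c" for t
  have "k 0 \<le> k 1"
  proof (rule DERIV_nonneg_imp_nondecreasing[where f = k and a = 0 and b = 1])
    fix t :: real assume t: "0 \<le> t" "t \<le> 1"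
    let ?\<psi> = "\<lambda>x. \<phi> (x - t *\<^sub>R v)"
    have \<psi>: "test_function ?\<psi>" by (rule test_function_translate[OF \<phi>(1)])
    have "norm x \<le> r + norm v" if "?\<psi> x \<noteq> 0" for x
    proof -
      have "norm (t *\<^sub>R v) \<le> norm v" using t by (simp add: mult_left_le_one_le)
      then show ?thesis
        using norm_triangle_ineq[of "x - t *\<^sub>R v" "t *\<^sub>R v"] \<phi>(3)[OF that] by simp
    qed
    from weak_one_sided_lower[OF \<psi> \<phi>(2) this \<open>r + norm v < \<rho>\<close> upper \<open>0 \<le> \<nu>\<close> div[OF \<psi> \<phi>(2)], of v]
    have "(\<integral>x. frechet_derivative ?\<psi> (at x) v * (\<beta> x \<bullet> v) \<partial>lborel) \<le>
      (\<mu> + \<nu> * DIM('a)) * (norm v)\<^sup>2 * (\<integral>x. ?\<psi> x \<partial>lborel)" .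
    also have "(\<integral>x. ?\<psi> x \<partial>lborel) = ?I"
      using integral_lborel_translate[of \<phi> "- t *\<^sub>R v"] by simp
    finally have "0 \<le> - (\<integral>x. frechet_derivative ?\<psi> (at x) v * (\<beta> x \<bullet> v) \<partial>lborel) + ?c"
      by simp
    moreover have "frechet_derivative ?\<psi> (at x) v = frechet_derivative \<phi> (at (x - t *\<^sub>R v)) v" for x
      using has_derivative_test_function[OF \<phi>(1)]
      by (subst frechet_derivative_translate) (auto simp: differentiable_def)
    ultimately have "0 \<le> - (\<integral>x. frechet_derivative \<phi> (at (x - t *\<^sub>R v)) v * (\<beta> x \<bullet> v) \<partial>lborel) + ?c"
      by simp
    moreover have "(k has_real_derivative
        - (\<integral>x. frechet_derivative \<phi> (at (x - t *\<^sub>R v)) v * (\<beta> x \<bullet> v) \<partial>lborel) + 1 * ?c) (at t)"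
      unfolding k_def using inner_field_bound
      by (intro DERIV_add DERIV_cmult_right DERIV_ident has_derivative_integral_translate[OF \<phi>(1)]) auto
    ultimately show "\<exists>y. (k has_real_derivative y) (at t) \<and> 0 \<le> y"
      by auto
  qed simp
  then have "0 \<le> (\<integral>x. \<phi> x * ((\<beta> (x + v) - \<beta> x) \<bullet> v) \<partial>lborel) + ?c"
    using integral_translate_diff[OF \<phi>(1), of v v] by (simp add: k_def)
  also have "\<dots> = (\<integral>x. \<phi> x * ((\<beta> (x + v) - \<beta> x) \<bullet> v + (\<mu> + \<nu> * DIM('a)) * (norm v)\<^sup>2) \<partial>lborel)"
  proof -
    have "\<bar>(\<beta> (x + v) - \<beta> x) \<bullet> v\<bar> \<le> M * norm v + M * norm v" for x
      using inner_field_bound[of "x + v" v] inner_field_bound[of x v] by (simp add: inner_diff_left)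
    then have "integrable lborel (\<lambda>x. \<phi> x * ((\<beta> (x + v) - \<beta> x) \<bullet> v))"
      by (intro integrable_test_function_mult[OF \<phi>(1)]) auto
    moreover define E where "E = (\<mu> + \<nu> * DIM('a)) * (norm v)\<^sup>2"
    moreover have "integrable lborel (\<lambda>x. \<phi> x * E)"
      by (intro integrable_test_function_mult[OF \<phi>(1)]) auto
    ultimately show ?thesis
      unfolding E_def[symmetric] by (simp add: distrib_left mult.commute[of E])
  qed
  finally show ?thesis .
qed

text \<open>Letting the test functions tend to indicators of boxes turns the integrated bound into
  nonnegative integrals over boxes, which determine the sign almost everywhere.\<close>

lemma AE_one_sided_lower:
  assumes ab: "cbox a b \<subseteq> cball 0 r" and "r + norm v < \<rho>"
    and upper: "\<And>u. AE x in lborel. norm x < \<rho> \<longrightarrow> norm (x + u) < \<rho> \<longrightarrow>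
      (\<beta> (x + u) - \<beta> x) \<bullet> u \<le> \<nu> * (norm u)\<^sup>2"
    and "0 \<le> \<nu>"
    and div: "\<And>\<phi>. test_function \<phi> \<Longrightarrow> (\<And>x. 0 \<le> \<phi> x) \<Longrightarrow>
      (\<integral>x. frechet_derivative \<phi> (at x) (\<beta> x) \<partial>lborel) \<le> \<mu> * (\<integral>x. \<phi> x \<partial>lborel)"
  shows "AE x in lborel. x \<in> cbox a b \<longrightarrow>
    0 \<le> (\<beta> (x + v) - \<beta> x) \<bullet> v + (\<mu> + \<nu> * DIM('a)) * (norm v)\<^sup>2"
proof (rule AE_nonneg_if_box_integrals_nonneg)
  let ?W = "\<lambda>x. (\<beta> (x + v) - \<beta> x) \<bullet> v + (\<mu> + \<nu> * DIM('a)) * (norm v)\<^sup>2"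
  let ?B = "M * norm v + M * norm v + \<bar>(\<mu> + \<nu> * DIM('a)) * (norm v)\<^sup>2\<bar>"
  show W: "?W \<in> borel_measurable borel" by measurable
  show B: "\<bar>?W x\<bar> \<le> ?B" for x
    using inner_field_bound[of "x + v" v] inner_field_bound[of x v]
    by (simp add: inner_diff_left)
  have B0: "0 \<le> ?B" using B[of 0] by linarith
  fix c d :: 'a assume cd: "cbox c d \<subseteq> cbox a b"
  obtain \<phi> :: "nat \<Rightarrow> 'a \<Rightarrow> real"
    where \<phi>: "\<And>n. test_function (\<phi> n)" "\<And>n x. 0 \<le> \<phi> n x" "\<And>n x. \<phi> n x \<le> 1"
      "\<And>n x. x \<notin> box c d \<Longrightarrow> \<phi> n x = 0" "\<And>x. (\<lambda>n. \<phi> n x) \<longlonglongrightarrow> indicator (box c d) x"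
    using indicator_box_approx by blast
  note [measurable] = borel_measurable_continuous_onI[OF continuous_test_function[OF \<phi>(1)]]
  have "norm x \<le> r" if "\<phi> n x \<noteq> 0" for n x
    using \<phi>(4)[of x n] that box_subset_cbox cd ab by (metis mem_cball_0 subsetD)
  from integrated_one_sided_lower[OF \<phi>(1,2) this \<open>r + norm v < \<rho>\<close> upper \<open>0 \<le> \<nu>\<close> div]
  have "0 \<le> (\<integral>x. \<phi> n x * ?W x \<partial>lborel)" for n .
  moreover have "(\<lambda>n. \<integral>x. \<phi> n x * ?W x \<partial>lborel) \<longlonglongrightarrow> (\<integral>x. indicator (box c d) x * ?W x \<partial>lborel)"
  proof (rule integral_dominated_convergence)
    show "integrable lborel (\<lambda>x. indicator (box c d) x * ?B)"
      using emeasure_lborel_box_finite[of c d]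
      by (intro integrable_mult_left integrable_real_indicator) auto
    show "AE x in lborel. (\<lambda>n. \<phi> n x * ?W x) \<longlonglongrightarrow> indicator (box c d) x * ?W x"
      by (intro AE_I2 tendsto_mult \<phi> tendsto_const)
    show "AE x in lborel. norm (\<phi> n x * ?W x) \<le> indicator (box c d) x * ?B" for n
    proof (rule AE_I2)
      fix x
      have *: "\<bar>\<phi> n x\<bar> \<le> indicator (box c d) x"
        using \<phi>(2,3)[of n x] \<phi>(4)[of x n] by (auto split: split_indicator)
      show "norm (\<phi> n x * ?W x) \<le> indicator (box c d) x * ?B"
        unfolding real_norm_def abs_mult[of "\<phi> n x"] by (rule mult_mono[OF * B]) auto
    qed
  qed measurable
  ultimately show "0 \<le> (\<integral>x. indicator (box c d) x * ?W x \<partial>lborel)"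
    by (intro LIMSEQ_le_const) auto
qed

end

lemma AE_lborel_translate:
  fixes P :: "'a::euclidean_space \<Rightarrow> bool"
  assumes "AE x in lborel. P x"
  shows "AE x in lborel. P (x + c)"
proof -
  have "AE x in distr lborel borel ((+) c). P x"
    unfolding lborel_distr_plus by (rule assms)
  then have "AE x in lborel. P (c + x)"
    by (rule AE_distrD[rotated]) simp
  then show ?thesis by (simp add: add.commute)
qed

text \<open>With \<open>\<sigma> = 1\<close> this transfers the upper bound, with
  \<open>\<sigma> = -1\<close> the lower one.\<close>

lemma essential_points_one_sided:
  fixes \<beta> :: "'a::euclidean_space \<Rightarrow> 'a"
  assumes \<beta>: "\<beta> \<in> borel_measurable borel"
    and ae: "AE z in lborel \<Otimes>\<^sub>M lborel. norm (fst z) < \<rho> \<longrightarrow> norm (snd z) < \<rho> \<longrightarrow>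
      \<sigma> * ((\<beta> (fst z) - \<beta> (snd z)) \<bullet> (fst z - snd z)) \<le> \<nu> * (norm (fst z - snd z))\<^sup>2"
    and xy: "x \<in> essential_points \<beta>" "y \<in> essential_points \<beta>" "norm x < \<rho>" "norm y < \<rho>"
  shows "\<sigma> * ((\<beta> x - \<beta> y) \<bullet> (x - y)) \<le> \<nu> * (norm (x - y))\<^sup>2"
proof -
  let ?F = "\<lambda>x y u v :: 'a. \<sigma> * ((u - v) \<bullet> (x - y)) - \<nu> * (norm (x - y))\<^sup>2"
  have "?F x y (\<beta> x) (\<beta> y) \<le> 0"
  proof (rule essential_points_le[where F = ?F and U = "ball 0 \<rho>", OF \<beta>])
    show "continuous_on UNIV (\<lambda>(x, y, u, v). ?F x y u v)"
      by (auto simp: case_prod_beta' intro!: continuous_intros)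
    show "AE z in lborel \<Otimes>\<^sub>M lborel. fst z \<in> ball 0 \<rho> \<longrightarrow> snd z \<in> ball 0 \<rho> \<longrightarrow>
        ?F (fst z) (snd z) (\<beta> (fst z)) (\<beta> (snd z)) \<le> 0"
      using ae by (rule eventually_mono) auto
  qed (use xy in auto)
  then show ?thesis by simp
qed

lemma essential_points_two_sided:
  fixes \<beta> :: "'a::euclidean_space \<Rightarrow> 'a"
  assumes \<beta>[measurable]: "\<beta> \<in> borel_measurable borel" and M: "\<And>x. norm (\<beta> x) \<le> M"
    and upper: "\<And>\<rho>. \<exists>\<nu>\<ge>0. AE z in lborel \<Otimes>\<^sub>M lborel. norm (fst z) < \<rho> \<longrightarrow> norm (snd z) < \<rho> \<longrightarrow>
      (\<beta> (fst z) - \<beta> (snd z)) \<bullet> (fst z - snd z) \<le> \<nu> * (norm (fst z - snd z))\<^sup>2"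
    and div: "\<And>\<phi>. test_function \<phi> \<Longrightarrow> (\<And>x. 0 \<le> \<phi> x) \<Longrightarrow>
      (\<integral>x. frechet_derivative \<phi> (at x) (\<beta> x) \<partial>lborel) \<le> \<mu> * (\<integral>x. \<phi> x \<partial>lborel)"
  obtains \<nu> where "0 \<le> \<nu>"
    "\<And>x y. x \<in> essential_points \<beta> \<Longrightarrow> y \<in> essential_points \<beta> \<Longrightarrow> norm x < \<rho> \<Longrightarrow> norm y < \<rho> \<Longrightarrow>
      \<bar>(\<beta> x - \<beta> y) \<bullet> (x - y)\<bar> \<le> \<nu> * (norm (x - y))\<^sup>2"
proof -
  obtain a b :: 'a where ab: "ball 0 \<rho> \<subseteq> cbox a b"
    using bounded_subset_cbox_symmetric[OF bounded_ball] by metis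
  obtain r where r: "cbox a b \<subseteq> cball 0 r" "0 < r"
    using bounded_cbox[of a b] unfolding bounded_pos by (metis mem_cball_0 subsetI)
  \<comment> \<open>Two points of the ball of radius \<open>\<rho>\<close> differ by less than
    \<open>2 * \<rho>\<close>, so the upper bound is taken on a ball that contains the box enlarged
    by any such increment. Absolute values serve because \<open>\<rho>\<close> has no prescribed
    sign.\<close>
  define \<rho>' where "\<rho>' = r + 2 * \<bar>\<rho>\<bar> + \<bar>\<rho>\<bar> + 1"
  obtain \<nu> where \<nu>: "0 \<le> \<nu>"
    "AE z in lborel \<Otimes>\<^sub>M lborel. norm (fst z) < \<rho>' \<longrightarrow> norm (snd z) < \<rho>' \<longrightarrow>
      (\<beta> (fst z) - \<beta> (snd z)) \<bullet> (fst z - snd z) \<le> \<nu> * (norm (fst z - snd z))\<^sup>2"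
    using upper by blast
  have up: "(\<beta> x - \<beta> y) \<bullet> (x - y) \<le> \<nu> * (norm (x - y))\<^sup>2"
    if "x \<in> essential_points \<beta>" "y \<in> essential_points \<beta>" "norm x < \<rho>'" "norm y < \<rho>'" for x y
    using essential_points_one_sided[OF \<beta>, of \<rho>' 1 \<nu> x y] \<nu>(2) that by simp
  \<comment> \<open>From almost every pair, Fubini alone would give the bound only for almost every
    increment \<open>u\<close>. The detour through essential points gives it for every
    \<open>u\<close>, as the difference quotients in a fixed direction require: for each
    \<open>u\<close>, almost every \<open>x\<close> has both \<open>x\<close> and
    \<open>x + u\<close> essential.\<close>
  have up_AE: "AE x in lborel. norm x < \<rho>' \<longrightarrow> norm (x + u) < \<rho>' \<longrightarrow>
      (\<beta> (x + u) - \<beta> x) \<bullet> u \<le> \<nu> * (norm u)\<^sup>2" for u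
    using AE_essential_points[OF \<beta>] AE_lborel_translate[OF AE_essential_points[OF \<beta>], of u]
    by eventually_elim (use up[of "_ + u"] in force)
  define C where "C = \<mu> + \<nu> * DIM('a)"
  have "AE z in lborel \<Otimes>\<^sub>M lborel. norm (fst z) < \<rho> \<longrightarrow> norm (snd z) < \<rho> \<longrightarrow>
      0 \<le> (\<beta> (snd z) - \<beta> (fst z)) \<bullet> (snd z - fst z) + C * (norm (snd z - fst z))\<^sup>2"
  proof (rule AE_pair_translate[where P = "\<lambda>x y. norm x < \<rho> \<longrightarrow> norm y < \<rho> \<longrightarrow>
      0 \<le> (\<beta> y - \<beta> x) \<bullet> (y - x) + C * (norm (y - x))\<^sup>2"])
    have "{z \<in> space (borel \<Otimes>\<^sub>M borel). norm (fst z) < \<rho> \<longrightarrow> norm (snd z) < \<rho> \<longrightarrow>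
        0 \<le> (\<beta> (snd z) - \<beta> (fst z)) \<bullet> (snd z - fst z) + C * (norm (snd z - fst z))\<^sup>2}
        \<in> sets (borel \<Otimes>\<^sub>M borel)"
      by measurable
    then show "{z. norm (fst z) < \<rho> \<longrightarrow> norm (snd z) < \<rho> \<longrightarrow>
        0 \<le> (\<beta> (snd z) - \<beta> (fst z)) \<bullet> (snd z - fst z) + C * (norm (snd z - fst z))\<^sup>2}
        \<in> sets (borel \<Otimes>\<^sub>M borel)"
      by (simp add: space_pair_measure)
    fix v :: 'a
    show "AE x in lborel. norm x < \<rho> \<longrightarrow> norm (x + v) < \<rho> \<longrightarrow>
        0 \<le> (\<beta> (x + v) - \<beta> x) \<bullet> (x + v - x) + C * (norm (x + v - x))\<^sup>2"
    proof (cases "norm v < 2 * \<rho>")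
      case True
      then have "r + norm v < \<rho>'" by (simp add: \<rho>'_def)
      from AE_one_sided_lower[OF \<beta> M r(1) this up_AE \<nu>(1) div]
      have "AE x in lborel. x \<in> cbox a b \<longrightarrow> 0 \<le> (\<beta> (x + v) - \<beta> x) \<bullet> v + C * (norm v)\<^sup>2"
        unfolding C_def .
      then show ?thesis
        by (rule eventually_mono) (use ab in auto)
    next
      case False
      have "\<not> (norm x < \<rho> \<and> norm (x + v) < \<rho>)" for x
        using False norm_triangle_ineq4[of "x + v" x] by auto
      then show ?thesis by auto
    qed
  qed
  then have low: "AE z in lborel \<Otimes>\<^sub>M lborel. norm (fst z) < \<rho> \<longrightarrow> norm (snd z) < \<rho> \<longrightarrow>
      - 1 * ((\<beta> (fst z) - \<beta> (snd z)) \<bullet> (fst z - snd z)) \<le> C * (norm (fst z - snd z))\<^sup>2"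
    by (rule eventually_mono) (auto simp: algebra_simps norm_minus_commute)
  show ?thesis
  proof
    show "0 \<le> max \<nu> C" using \<nu>(1) by simp
    fix x y assume xy: "x \<in> essential_points \<beta>" "y \<in> essential_points \<beta>" "norm x < \<rho>" "norm y < \<rho>"
    have "norm x < \<rho>'" "norm y < \<rho>'" using xy r(2) by (auto simp: \<rho>'_def)
    then have "(\<beta> x - \<beta> y) \<bullet> (x - y) \<le> \<nu> * (norm (x - y))\<^sup>2"
      using up xy by blast
    also have "\<dots> \<le> max \<nu> C * (norm (x - y))\<^sup>2"
      by (intro mult_right_mono) auto
    finally have 1: "(\<beta> x - \<beta> y) \<bullet> (x - y) \<le> max \<nu> C * (norm (x - y))\<^sup>2" .
    have "- 1 * ((\<beta> x - \<beta> y) \<bullet> (x - y)) \<le> C * (norm (x - y))\<^sup>2"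
      by (rule essential_points_one_sided[OF \<beta> low xy])
    also have "\<dots> \<le> max \<nu> C * (norm (x - y))\<^sup>2"
      by (intro mult_right_mono) auto
    finally show "\<bar>(\<beta> x - \<beta> y) \<bullet> (x - y)\<bar> \<le> max \<nu> C * (norm (x - y))\<^sup>2"
      using 1 by (intro abs_leI) simp_all
  qed
qed

section \<open>Euler iterates avoid null sets\<close>

text \<open>
  The field is only controlled off a null set, so an Euler step must not carry a set of positive
  measure into a null set. An expansive map has a Lipschitz inverse, which preserves null sets.
\<close>

lemma negligible_preimage_expansive:
  fixes F :: "'a::euclidean_space \<Rightarrow> 'a"
  assumes G: "negligible (- G)"
    and F: "\<And>x y. x \<in> G \<inter> S \<Longrightarrow> y \<in> G \<inter> S \<Longrightarrow> norm (x - y) \<le> K * norm (F x - F y)"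
    and Z: "negligible Z"
  shows "negligible {x \<in> S. F x \<in> Z}"
proof -
  let ?g = "inv_into (G \<inter> S) F"
  have g: "?g z \<in> G \<inter> S" "F (?g z) = z" if "z \<in> F ` (G \<inter> S)" for z
    using that inv_into_into f_inv_into_f by metis+
  have "inj_on F (G \<inter> S)"
    using F by (force intro: inj_onI)
  then have gF: "?g (F x) = x" if "x \<in> G \<inter> S" for x
    using that by (rule inv_into_f_f)
  have "negligible (?g ` (Z \<inter> F ` (G \<inter> S)))"
  proof (rule negligible_locally_Lipschitz_image[OF order_refl])
    show "negligible (Z \<inter> F ` (G \<inter> S))"
      using Z by (rule negligible_subset) auto
    show "\<exists>T B. open T \<and> x \<in> T \<and>
        (\<forall>y\<in>(Z \<inter> F ` (G \<inter> S)) \<inter> T. norm (?g y - ?g x) \<le> B * norm (y - x))"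
      if "x \<in> Z \<inter> F ` (G \<inter> S)" for x
      using that F g by (intro exI[of _ UNIV] exI[of _ K]) (metis IntD1 IntD2 UNIV_I open_UNIV)
  qed
  with G have "negligible (- G \<union> ?g ` (Z \<inter> F ` (G \<inter> S)))"
    by (rule negligible_Un)
  moreover have "{x \<in> S. F x \<in> Z} \<subseteq> - G \<union> ?g ` (Z \<inter> F ` (G \<inter> S))"
  proof
    fix x assume x: "x \<in> {x \<in> S. F x \<in> Z}"
    show "x \<in> - G \<union> ?g ` (Z \<inter> F ` (G \<inter> S))"
    proof (cases "x \<in> G")
      case True
      with x have "x = ?g (F x)" "F x \<in> Z \<inter> F ` (G \<inter> S)" using gF by auto
      then show ?thesis by blast
    qed simp
  qed
  ultimately show ?thesis by (rule negligible_subset)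
qed

lemma euler_diff_bound:
  fixes b :: "'a::real_normed_vector \<Rightarrow> 'a"
  assumes M: "\<And>x. norm (b x) \<le> M" and "0 \<le> h"
  shows "norm (euler b h n x - x) \<le> real n * h * M"
proof (induction n)
  case (Suc n)
  have "norm (h *\<^sub>R b (euler b h n x)) \<le> h * M"
    using M \<open>0 \<le> h\<close> by (simp add: mult_left_mono)
  then show ?case
    using Suc norm_triangle_ineq[of "euler b h n x - x" "h *\<^sub>R b (euler b h n x)"]
    by (simp add: algebra_simps)
qed simp

text \<open>Induction with \<open>Z\<close> varying: \<open>n + 1\<close> steps lead into
  \<open>Z\<close> exactly when \<open>n\<close> steps lead into the one-step preimage of
  \<open>Z\<close>, which is negligible again. The condition on \<open>\<rho>\<close> keeps the
  iterates where \<open>b\<close> is controlled.\<close>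

lemma negligible_euler_preimage:
  fixes b :: "'a::euclidean_space \<Rightarrow> 'a"
  assumes G: "negligible (- G)" and M: "\<And>x. norm (b x) \<le> M" and h: "0 \<le> h" "h * \<nu> \<le> 1 / 2"
    and b: "\<And>x y. x \<in> G \<Longrightarrow> y \<in> G \<Longrightarrow> norm x < \<rho> \<Longrightarrow> norm y < \<rho> \<Longrightarrow>
      \<bar>(b x - b y) \<bullet> (x - y)\<bar> \<le> \<nu> * (norm (x - y))\<^sup>2"
    and "R + real n * h * M \<le> \<rho>" and Z: "negligible Z"
  shows "negligible {x \<in> ball 0 R. euler b h n x \<in> Z}"
  using \<open>R + real n * h * M \<le> \<rho>\<close> Z
proof (induction n arbitrary: Z)
  case 0
  show ?case
    by (rule negligible_subset[OF 0(2)]) auto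
next
  case (Suc n)
  let ?F = "\<lambda>x. x + h *\<^sub>R b x"
  have "0 \<le> M" using M norm_ge_zero order_trans by blast
  then have "0 \<le> h * M" using h by simp
  with Suc.prems(1) have n: "R + real n * h * M \<le> \<rho>" by (simp add: algebra_simps)
  \<comment> \<open>The lower bound gives \<open>(?F x - ?F y) \<bullet> (x - y) \<ge> (1 - h *
    \<nu>) * (norm (x - y))^2\<close>, and \<open>h * \<nu> \<le> 1/2\<close> with Cauchy-Schwarz
    yields the factor 2.\<close>
  have "norm (x - y) \<le> 2 * norm (?F x - ?F y)" if "x \<in> G \<inter> ball 0 \<rho>" "y \<in> G \<inter> ball 0 \<rho>" for x y
  proof (cases "x = y")
    case False
    have "- (\<nu> * (norm (x - y))\<^sup>2) \<le> (b x - b y) \<bullet> (x - y)"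
      using b[of x y] that by auto
    then have "h * - (\<nu> * (norm (x - y))\<^sup>2) \<le> h * ((b x - b y) \<bullet> (x - y))"
      using h by (intro mult_left_mono)
    moreover have "(h * \<nu>) * (norm (x - y))\<^sup>2 \<le> 1 / 2 * (norm (x - y))\<^sup>2"
      using h by (intro mult_right_mono) auto
    moreover have "(?F x - ?F y) \<bullet> (x - y) = (norm (x - y))\<^sup>2 + h * ((b x - b y) \<bullet> (x - y))"
      by (simp add: power2_norm_eq_inner inner_add_left inner_diff_left algebra_simps)
    moreover have "(?F x - ?F y) \<bullet> (x - y) \<le> norm (?F x - ?F y) * norm (x - y)"
      by (rule norm_cauchy_schwarz)
    ultimately have "1 / 2 * (norm (x - y))\<^sup>2 \<le> norm (?F x - ?F y) * norm (x - y)"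
      by simp
    then have "norm (x - y) * norm (x - y) \<le> (2 * norm (?F x - ?F y)) * norm (x - y)"
      by (simp add: power2_eq_square)
    then show ?thesis
      using False by (subst (asm) mult_le_cancel_right) simp
  qed simp
  then have "negligible {x \<in> ball 0 \<rho>. ?F x \<in> Z}"
    using G Suc.prems(2) by (intro negligible_preimage_expansive[where G = G and K = 2])
  from Suc.IH[OF n this]
  show ?case
  proof (rule negligible_subset, intro subsetI)
    fix x assume x: "x \<in> {x \<in> ball 0 R. euler b h (Suc n) x \<in> Z}"
    have "norm (euler b h n x) < \<rho>"
      using euler_diff_bound[of b M h n x] M h x n norm_triangle_ineq[of x "euler b h n x - x"] by auto
    with x show "x \<in> {x \<in> ball 0 R. euler b h n x \<in> {x \<in> ball 0 \<rho>. ?F x \<in> Z}}"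
      by auto
  qed
qed

section \<open>Flow trajectories avoid null sets\<close>

lemma lebesgue_measurable_ex_borel:
  fixes f :: "'a::euclidean_space \<Rightarrow> 'b::euclidean_space"
  assumes "f \<in> borel_measurable lebesgue"
  obtains g where "g \<in> borel_measurable borel" "AE x in lborel. f x = g x"
proof -
  have "\<forall>i\<in>Basis. \<exists>g. g \<in> borel_measurable lborel \<and> (AE x in lborel. f x \<bullet> i = g x)"
    using completion_ex_borel_measurable_real[of "\<lambda>x. f x \<bullet> _" lborel] assms
      borel_measurable_euclidean_space[of f lebesgue] by blast
  then obtain g where g: "\<And>i. i \<in> Basis \<Longrightarrow> g i \<in> borel_measurable lborel"
    "\<And>i. i \<in> Basis \<Longrightarrow> AE x in lborel. f x \<bullet> i = g i x"
    by metis
  show ?thesis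
  proof
    show "(\<lambda>x. \<Sum>i\<in>Basis. g i x *\<^sub>R i) \<in> borel_measurable borel"
      using g(1) by (intro borel_measurable_sum borel_measurable_scaleR) auto
    have "AE x in lborel. \<forall>i\<in>Basis. f x \<bullet> i = g i x"
      using g(2) by (intro AE_finite_allI) auto
    then show "AE x in lborel. f x = (\<Sum>i\<in>Basis. g i x *\<^sub>R i)"
    proof (rule eventually_mono)
      fix x assume "\<forall>i\<in>Basis. f x \<bullet> i = g i x"
      then have "(\<Sum>i\<in>Basis. g i x *\<^sub>R i) = (\<Sum>i\<in>Basis. (f x \<bullet> i) *\<^sub>R i)"
        by (intro sum.cong) auto
      then show "f x = (\<Sum>i\<in>Basis. g i x *\<^sub>R i)"
        by (simp add: euclidean_representation)
    qed
  qed
qed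

text \<open>Exchanging "every \<open>t\<close>, almost every \<open>x\<close>" requires joint
  measurability, while \<open>X\<close> is given as measurable for each \<open>t\<close> separately.
  Continuity in time supplies a jointly Borel \<open>Y\<close> that agrees with \<open>X\<close> on
  almost every path, and Fubini is applied to \<open>Y\<close>.\<close>

lemma AE_AE_notin_continuous_process:
  fixes X :: "real \<Rightarrow> 'a::euclidean_space \<Rightarrow> 'b::euclidean_space"
  assumes "0 \<le> T"
    and cont: "AE x in lborel. continuous_on {0..T} (\<lambda>t. X t x)"
    and meas: "\<And>t. t \<in> {0..T} \<Longrightarrow> X t \<in> borel_measurable lebesgue"
    and null: "\<And>t. t \<in> {0..T} \<Longrightarrow> AE x in lborel. X t x \<notin> Z"
    and Z[measurable]: "Z \<in> sets borel"
  shows "AE x in lborel. AE t in lborel. t \<in> {0..T} \<longrightarrow> X t x \<notin> Z"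
proof -
  \<comment> \<open>Time grid of mesh \<open>1 / Suc k\<close>, capped at \<open>T\<close> so that
    every sample lies in the time interval.\<close>
  define \<tau> where "\<tau> k j = min T (real j / real (Suc k))" for k j :: nat
  have \<tau>: "\<tau> k j \<in> {0..T}" for k j using \<open>0 \<le> T\<close> by (auto simp: \<tau>_def)
  have "\<forall>k j. \<exists>g. g \<in> borel_measurable borel \<and> (AE x in lborel. X (\<tau> k j) x = g x)"
    using lebesgue_measurable_ex_borel[OF meas[OF \<tau>]] by metis
  then obtain X' where X'[measurable]: "\<And>k j. X' k j \<in> borel_measurable borel"
    and eq: "\<And>k j. AE x in lborel. X (\<tau> k j) x = X' k j x"
    by metis
  define Y where "Y z = lim (\<lambda>k. X' k (nat \<lfloor>fst z * real (Suc k)\<rfloor>) (snd z))" for z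
  have Y[measurable]: "Y \<in> borel_measurable (borel \<Otimes>\<^sub>M borel)"
  proof -
    \<comment> \<open>The rounded time takes only countably many values, so each approximation is a
      countable gluing of Borel maps in \<open>x\<close>.\<close>
    have "(\<lambda>z. X' k (nat \<lfloor>fst z * real (Suc k)\<rfloor>) (snd z)) \<in> borel_measurable (borel \<Otimes>\<^sub>M borel)" for k
      by (rule measurable_compose_countable[where f = "\<lambda>j z. X' k j (snd z)"]) measurable
    then show ?thesis
      unfolding Y_def by (rule borel_measurable_lim_metric)
  qed
  have good: "AE x in lborel. \<forall>t\<in>{0..T}. Y (t, x) = X t x"
  proof -
    have "AE x in lborel. \<forall>k j. X (\<tau> k j) x = X' k j x"
      using eq by (simp add: AE_all_countable)
    with cont show ?thesis
    proof (eventually_elim, intro ballI)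
      fix x t
      assume cont: "continuous_on {0..T} (\<lambda>t. X t x)" and eq: "\<forall>k j. X (\<tau> k j) x = X' k j x"
        and t: "t \<in> {0..T}"
      let ?\<tau> = "\<lambda>k. \<tau> k (nat \<lfloor>t * real (Suc k)\<rfloor>)"
      have bounds: "t - inverse (real (Suc k)) \<le> ?\<tau> k" "?\<tau> k \<le> t" for k
      proof -
        have "real (nat \<lfloor>t * real (Suc k)\<rfloor>) = of_int \<lfloor>t * real (Suc k)\<rfloor>"
          using t by simp
        then have "t * real (Suc k) - 1 \<le> real (nat \<lfloor>t * real (Suc k)\<rfloor>)"
          "real (nat \<lfloor>t * real (Suc k)\<rfloor>) \<le> t * real (Suc k)"
          by linarith+
        from divide_right_mono[OF this(1), of "real (Suc k)"] divide_right_mono[OF this(2), of "real (Suc k)"]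
        have "t - inverse (real (Suc k)) \<le> real (nat \<lfloor>t * real (Suc k)\<rfloor>) / real (Suc k)"
          "real (nat \<lfloor>t * real (Suc k)\<rfloor>) / real (Suc k) \<le> t"
          by (simp_all add: diff_divide_distrib inverse_eq_divide del: of_nat_Suc)
        moreover have "t - inverse (real (Suc k)) \<le> T"
        proof -
          have "0 \<le> inverse (real (Suc k))" by simp
          with t show ?thesis unfolding atLeastAtMost_iff by linarith
        qed
        ultimately show "t - inverse (real (Suc k)) \<le> ?\<tau> k" "?\<tau> k \<le> t"
          by (auto simp: \<tau>_def min_le_iff_disj)
      qed
      have "?\<tau> \<longlonglongrightarrow> t"
      proof (rule tendsto_sandwich)
        show "(\<lambda>k. t - inverse (real (Suc k))) \<longlonglongrightarrow> t"
          using tendsto_diff[OF tendsto_const[of t] LIMSEQ_inverse_real_of_nat] by simp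
        show "(\<lambda>k. t) \<longlonglongrightarrow> t" by simp
      qed (use bounds in auto)
      then have "(\<lambda>k. X (?\<tau> k) x) \<longlonglongrightarrow> X t x"
        using \<tau> by (intro continuous_on_tendsto_compose[OF cont _ t]) auto
      then show "Y (t, x) = X t x"
        unfolding Y_def using eq by (auto intro: limI)
    qed
  qed
  let ?P = "\<lambda>t x. t \<in> {0..T} \<longrightarrow> Y (t, x) \<notin> Z"
  have "AE t in lborel. AE x in lborel. ?P t x"
  proof (rule AE_I2)
    fix t
    show "AE x in lborel. ?P t x"
    proof (cases "t \<in> {0..T}")
      case True
      from good null[OF this] show ?thesis
        by eventually_elim auto
    next
      case False
      then show ?thesis by (intro AE_I2) auto
    qed
  qed
  moreover have "{z \<in> space (borel \<Otimes>\<^sub>M borel). fst z \<in> {0..T} \<longrightarrow> Y z \<notin> Z} \<in> sets (borel \<Otimes>\<^sub>M borel)"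
    by measurable
  then have "{z \<in> space (lborel \<Otimes>\<^sub>M lborel). ?P (fst z) (snd z)} \<in> sets (lborel \<Otimes>\<^sub>M lborel)"
    by (simp add: space_pair_measure)
  ultimately have "AE x in lborel. AE t in lborel. ?P t x"
    by (subst (asm) lborel_pair.AE_commute) auto
  with good show ?thesis
  proof eventually_elim
    case (elim x)
    from elim(2) show ?case
      by (rule eventually_mono) (use elim(1) in auto)
  qed
qed

section \<open>Error recursion\<close>

lemma integral_inner_le_AE:
  fixes e :: "real \<Rightarrow> 'a::euclidean_space"
  assumes "a \<le> b" and e: "e integrable_on {a..b}"
    and "AE s in lborel. s \<in> {a..b} \<longrightarrow> w \<bullet> e s \<le> k"
  shows "w \<bullet> integral {a..b} e \<le> k * (b - a)"
proof -
  let ?N = "{s \<in> space lborel. \<not> (s \<in> {a..b} \<longrightarrow> w \<bullet> e s \<le> k)}"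
  have "AE s in lebesgue. s \<in> {a..b} \<longrightarrow> w \<bullet> e s \<le> k"
    using assms(3) by (rule AE_completion)
  then have N: "negligible ?N"
    unfolding negligible_iff_null_sets by (simp add: completion.AE_iff_null_sets)
  have "((\<lambda>s. w \<bullet> e s) has_integral w \<bullet> integral {a..b} e) {a..b}"
    using has_integral_linear[OF integrable_integral[OF e] bounded_linear_inner_right[of w]]
    by (simp add: o_def)
  then have "((\<lambda>s. if s \<in> ?N then k else w \<bullet> e s) has_integral w \<bullet> integral {a..b} e) {a..b}"
    by (rule has_integral_spike[OF N, rotated]) auto
  moreover have "((\<lambda>s. k) has_integral k * (b - a)) {a..b}"
    using has_integral_const_real[of k a b] \<open>a \<le> b\<close> by (simp add: mult.commute)
  ultimately show ?thesis
    by (rule has_integral_le) auto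
qed

lemma integral_norm_bound_interval:
  fixes f :: "real \<Rightarrow> 'a::euclidean_space"
  assumes "a \<le> b" "f integrable_on {a..b}" "\<And>s. norm (f s) \<le> B"
  shows "norm (integral {a..b} f) \<le> B * (b - a)"
proof -
  have "0 \<le> B" using assms(3)[of a] norm_ge_zero order_trans by blast
  then show ?thesis
    using has_integral_bound[of B f "integral {a..b} f" a b] assms integrable_integral[of f "{a..b}"]
    by simp
qed

text \<open>Expand the square of \<open>?E + integral {t..t + h} ?e\<close>. In the cross term,
  \<open>?E\<close> is \<open>(u s - y) - (u s - u t)\<close>: the first part falls under
  \<open>one\<close>, and the second is at most \<open>h * M\<close> in norm because the path has
  speed at most \<open>M\<close>.\<close>

lemma euler_step_error:
  fixes b :: "'a::euclidean_space \<Rightarrow> 'a"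
  assumes M: "\<And>y. norm (b y) \<le> M" and "0 \<le> h" "0 \<le> \<nu>" "0 \<le> t"
    and int: "(\<lambda>s. b (u s)) integrable_on {t..t + h}"
    and u: "\<And>s. s \<in> {t..t + h} \<Longrightarrow> u s = u t + integral {t..s} (\<lambda>s. b (u s))"
    and one: "AE s in lborel. s \<in> {t..t + h} \<longrightarrow> (b (u s) - b y) \<bullet> (u s - y) \<le> \<nu> * (norm (u s - y))\<^sup>2"
  shows "(norm (u (t + h) - (y + h *\<^sub>R b y)))\<^sup>2 \<le>
    (1 + 4 * \<nu> * h) * (norm (u t - y))\<^sup>2 + (8 * M\<^sup>2 + 4 * \<nu> * h * M\<^sup>2) * h\<^sup>2"
proof -
  have "0 \<le> M" using M norm_ge_zero order_trans by blast
  let ?E = "u t - y" and ?e = "\<lambda>s. b (u s) - b y"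
  have e: "?e integrable_on {t..t + h}"
    by (intro integrable_diff int integrable_const_ivl)
  have ie: "integral {t..t + h} ?e = integral {t..t + h} (\<lambda>s. b (u s)) - h *\<^sub>R b y"
    using \<open>0 \<le> h\<close> by (subst integral_diff[OF int integrable_const_ivl]) auto
  have step: "u (t + h) - (y + h *\<^sub>R b y) = ?E + integral {t..t + h} ?e"
    using u[of "t + h"] \<open>0 \<le> h\<close> by (simp add: ie)
  have eM: "norm (?e s) \<le> 2 * M" for s
    using norm_triangle_ineq4[of "b (u s)" "b y"] M[of "u s"] M[of y] by linarith
  have ibound: "norm (integral {t..t + h} ?e) \<le> 2 * M * h"
    using integral_norm_bound_interval[OF _ e eM] \<open>0 \<le> h\<close> by simp
  \<comment> \<open>The first two terms come from \<open>(norm ?E + h * M)^2\<close>, bounded by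
    twice the sum of squares; the last is \<open>2 * M\<close>, the bound on \<open>?e\<close>,
    times the displacement \<open>h * M\<close>.\<close>
  let ?k = "2 * \<nu> * (norm ?E)\<^sup>2 + 2 * \<nu> * (h * M)\<^sup>2 + 2 * M * (h * M)"
  have "?E \<bullet> integral {t..t + h} ?e \<le> ?k * (t + h - t)"
  proof (rule integral_inner_le_AE[OF _ e])
    show "AE s in lborel. s \<in> {t..t + h} \<longrightarrow> ?E \<bullet> ?e s \<le> ?k"
      using one
    proof (eventually_elim, intro impI)
      fix s assume *: "s \<in> {t..t + h} \<longrightarrow> (b (u s) - b y) \<bullet> (u s - y) \<le> \<nu> * (norm (u s - y))\<^sup>2"
        and s: "s \<in> {t..t + h}"
      have "(\<lambda>s. b (u s)) integrable_on {t..s}"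
        using int s by (intro integrable_on_subinterval[OF int]) auto
      then have "norm (u s - u t) \<le> M * (s - t)"
        using integral_norm_bound_interval[of t s "\<lambda>s. b (u s)" M] u[OF s] M s by simp
      also have "\<dots> \<le> M * h" using s \<open>0 \<le> M\<close> by (intro mult_left_mono) auto
      finally have d: "norm (u s - u t) \<le> h * M" by (simp add: mult.commute)
      have "norm (u s - y) \<le> norm ?E + h * M"
        using norm_triangle_ineq[of "u s - u t" ?E] d by simp
      then have "(norm (u s - y))\<^sup>2 \<le> (norm ?E + h * M)\<^sup>2"
        by (rule power_mono) simp
      also have "\<dots> \<le> 2 * (norm ?E)\<^sup>2 + 2 * (h * M)\<^sup>2"
        using sum_squares_bound[of "norm ?E" "h * M"] by (simp add: power2_sum)
      finally have "\<nu> * (norm (u s - y))\<^sup>2 \<le> \<nu> * (2 * (norm ?E)\<^sup>2 + 2 * (h * M)\<^sup>2)"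
        using \<open>0 \<le> \<nu>\<close> by (rule mult_left_mono)
      moreover have "?E \<bullet> ?e s = ?e s \<bullet> (u s - y) - ?e s \<bullet> (u s - u t)"
        by (simp add: inner_diff_left inner_diff_right inner_commute)
      moreover have "- (?e s \<bullet> (u s - u t)) \<le> 2 * M * (h * M)"
        using Cauchy_Schwarz_ineq2[of "?e s" "u s - u t"]
          mult_mono[OF eM d, of s] \<open>0 \<le> M\<close> by simp
      ultimately show "?E \<bullet> ?e s \<le> ?k"
        using * s by (simp add: distrib_left)
    qed
  qed (use \<open>0 \<le> h\<close> in simp)
  then have "2 * (?E \<bullet> integral {t..t + h} ?e) \<le> 2 * (?k * h)"
    by simp
  moreover have "(norm (integral {t..t + h} ?e))\<^sup>2 \<le> (2 * M * h)\<^sup>2"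
    using ibound by (rule power_mono) simp
  moreover have "(norm (?E + integral {t..t + h} ?e))\<^sup>2 =
      (norm ?E)\<^sup>2 + 2 * (?E \<bullet> integral {t..t + h} ?e) + (norm (integral {t..t + h} ?e))\<^sup>2"
    by (simp add: power2_norm_eq_inner inner_add_left inner_add_right inner_commute)
  \<comment> \<open>The coefficient 8 is 4 from the displacement in the cross term plus 4 from the
    squared integral.\<close>
  moreover have "(norm ?E)\<^sup>2 + 2 * (?k * h) + (2 * M * h)\<^sup>2 =
      (1 + 4 * \<nu> * h) * (norm ?E)\<^sup>2 + (8 * M\<^sup>2 + 4 * \<nu> * h * M\<^sup>2) * h\<^sup>2"
    by (simp add: algebra_simps power2_eq_square)
  ultimately show ?thesis
    unfolding step by linarith
qed

text \<open>This form, rather than the geometric sum divided by \<open>q\<close>, remains meaningful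
  for \<open>q = 0\<close>, which occurs when \<open>\<nu> = 0\<close>.\<close>

lemma discrete_gronwall:
  fixes a :: "nat \<Rightarrow> real"
  assumes "a 0 = 0" "0 \<le> q" "0 \<le> c"
    and step: "\<And>n. n < N \<Longrightarrow> a (Suc n) \<le> (1 + q) * a n + c"
    and "n \<le> N"
  shows "a n \<le> real n * c * exp (real n * q)"
  using \<open>n \<le> N\<close>
proof (induction n)
  case (Suc n)
  have "a (Suc n) \<le> (1 + q) * (real n * c * exp (real n * q)) + c"
    using step[of n] mult_left_mono[of "a n" "real n * c * exp (real n * q)" "1 + q"] Suc \<open>0 \<le> q\<close>
    by linarith
  also have "\<dots> \<le> exp q * (real n * c * exp (real n * q)) + exp (real (Suc n) * q) * c"
    using \<open>0 \<le> q\<close> \<open>0 \<le> c\<close> mult_right_mono[of 1 "exp (real (Suc n) * q)" c]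
    by (intro add_mono mult_right_mono exp_ge_add_one_self) auto
  also have "\<dots> = real (Suc n) * c * exp (real (Suc n) * q)"
    by (simp add: algebra_simps exp_add)
  finally show ?case .
qed (use assms in simp)

lemma euler_error:
  fixes b :: "'a::euclidean_space \<Rightarrow> 'a"
  assumes M: "\<And>y. norm (b y) \<le> M" and "0 \<le> h" "0 \<le> \<nu>" "h \<le> T" "real N * h \<le> T"
    and int: "(\<lambda>s. b (u s)) integrable_on {0..T}"
    and u: "\<And>t. t \<in> {0..T} \<Longrightarrow> u t = x + integral {0..t} (\<lambda>s. b (u s))"
    and one: "\<And>n. n < N \<Longrightarrow> AE s in lborel. s \<in> {0..T} \<longrightarrow>
      (b (u s) - b (euler b h n x)) \<bullet> (u s - euler b h n x) \<le> \<nu> * (norm (u s - euler b h n x))\<^sup>2"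
    and "n \<le> N"
  shows "(norm (u (real n * h) - euler b h n x))\<^sup>2 \<le> T * (8 * M\<^sup>2 + 4 * \<nu> * T * M\<^sup>2) * exp (4 * \<nu> * T) * h"
proof -
  let ?a = "\<lambda>n. (norm (u (real n * h) - euler b h n x))\<^sup>2"
  let ?c = "8 * M\<^sup>2 + 4 * \<nu> * T * M\<^sup>2"
  have "0 \<le> T" using \<open>0 \<le> h\<close> \<open>h \<le> T\<close> by simp
  then have c: "0 \<le> ?c" using \<open>0 \<le> \<nu>\<close> by simp
  have "?a n \<le> real n * (?c * h\<^sup>2) * exp (real n * (4 * \<nu> * h))"
  proof (rule discrete_gronwall[where N = N])
    show "?a 0 = 0" using u[of 0] \<open>0 \<le> T\<close> by simp
    fix n assume "n < N"
    let ?t = "real n * h"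
    have "real (Suc n) * h \<le> real N * h"
      using \<open>n < N\<close> \<open>0 \<le> h\<close> by (intro mult_right_mono) auto
    then have t: "0 \<le> ?t" "?t + h \<le> T"
      using \<open>real N * h \<le> T\<close> \<open>0 \<le> h\<close> by (auto simp: algebra_simps)
    have int': "(\<lambda>s. b (u s)) integrable_on {?t..?t + h}"
      using t by (intro integrable_on_subinterval[OF int]) auto
    have "u s = u ?t + integral {?t..s} (\<lambda>s. b (u s))" if "s \<in> {?t..?t + h}" for s
    proof -
      have "(\<lambda>s. b (u s)) integrable_on {0..s}"
        using t that by (intro integrable_on_subinterval[OF int]) auto
      then have "integral {0..?t} (\<lambda>s. b (u s)) + integral {?t..s} (\<lambda>s. b (u s)) = integral {0..s} (\<lambda>s. b (u s))"
        using that t by (intro Henstock_Kurzweil_Integration.integral_combine) auto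
      moreover have "?t \<in> {0..T}" "s \<in> {0..T}"
        using that t \<open>0 \<le> h\<close> by (auto intro: order_trans[of 0 ?t s])
      ultimately show ?thesis using u[of s] u[of ?t] by (simp add: add.assoc)
    qed
    moreover have "AE s in lborel. s \<in> {?t..?t + h} \<longrightarrow> (b (u s) - b (euler b h n x)) \<bullet> (u s - euler b h n x)
        \<le> \<nu> * (norm (u s - euler b h n x))\<^sup>2"
      using one[OF \<open>n < N\<close>] by (rule eventually_mono) (use t in auto)
    ultimately have "(norm (u (?t + h) - (euler b h n x + h *\<^sub>R b (euler b h n x))))\<^sup>2 \<le>
        (1 + 4 * \<nu> * h) * ?a n + (8 * M\<^sup>2 + 4 * \<nu> * h * M\<^sup>2) * h\<^sup>2"
      by (rule euler_step_error[OF M \<open>0 \<le> h\<close> \<open>0 \<le> \<nu>\<close> t(1) int'])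
    moreover have "real (Suc n) * h = ?t + h"
      by (simp add: algebra_simps)
    ultimately have "?a (Suc n) \<le> (1 + 4 * \<nu> * h) * ?a n + (8 * M\<^sup>2 + 4 * \<nu> * h * M\<^sup>2) * h\<^sup>2"
      by (simp only: euler.simps)
    also have "(8 * M\<^sup>2 + 4 * \<nu> * h * M\<^sup>2) * h\<^sup>2 \<le> ?c * h\<^sup>2"
      using \<open>0 \<le> \<nu>\<close> \<open>h \<le> T\<close> by (intro mult_right_mono add_left_mono mult_left_mono) auto
    finally show "?a (Suc n) \<le> (1 + 4 * \<nu> * h) * ?a n + ?c * h\<^sup>2" by simp
  qed (use \<open>0 \<le> h\<close> \<open>0 \<le> \<nu>\<close> c \<open>n \<le> N\<close> in auto)
  \<comment> \<open>One factor \<open>h\<close> of the local error combines with the number of steps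
    into a time at most \<open>T\<close>; the other remains as the rate.\<close>
  also have "\<dots> = (real n * h) * (?c * h * exp (4 * \<nu> * (real n * h)))"
    by (simp add: power2_eq_square mult_ac)
  also have "\<dots> \<le> T * (?c * h * exp (4 * \<nu> * T))"
  proof -
    have "real n * h \<le> T"
      using mult_right_mono[of "real n" "real N" h] \<open>n \<le> N\<close> \<open>0 \<le> h\<close> \<open>real N * h \<le> T\<close> by simp
    moreover from this have "exp (4 * \<nu> * (real n * h)) \<le> exp (4 * \<nu> * T)"
      using \<open>0 \<le> \<nu>\<close> by (simp add: mult_left_mono)
    moreover have "0 \<le> ?c * h"
      using c \<open>0 \<le> h\<close> by (rule mult_nonneg_nonneg)
    ultimately show ?thesis
      using \<open>0 \<le> T\<close> c \<open>0 \<le> h\<close> by (intro mult_mono) auto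
  qed
  finally show ?thesis by (simp add: mult_ac)
qed

section \<open>Assembling the estimate\<close>

lemma AE_lborel_pair_fst_snd:
  fixes P :: "'a::euclidean_space \<Rightarrow> bool"
  assumes "AE x in lborel. P x"
  shows "AE z in lborel \<Otimes>\<^sub>M (lborel :: 'a measure). P (fst z) \<and> P (snd z)"
proof -
  obtain N where N: "N \<in> null_sets lborel" "{x. \<not> P x} \<subseteq> N"
    using assms unfolding eventually_ae_filter by auto
  have "N \<times> UNIV \<in> null_sets (lborel \<Otimes>\<^sub>M lborel)" "UNIV \<times> N \<in> null_sets (lborel \<Otimes>\<^sub>M lborel)"
    using N(1) by (auto simp: null_sets_def lborel.emeasure_pair_measure_Times)
  then have "N \<times> UNIV \<union> UNIV \<times> N \<in> null_sets (lborel \<Otimes>\<^sub>M lborel)"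
    by (rule null_sets.Un)
  then show ?thesis
    by (rule AE_I') (use N(2) in auto)
qed

text \<open>Since \<open>- D x \<le> max 0 (- D x) \<le> K\<close> almost everywhere and
  \<open>\<phi>\<close> is nonnegative, the distributional identity gives the bound. Passing to
  \<open>\<beta>\<close> and \<open>lborel\<close> alters integrands only on a null set.\<close>

lemma integral_derivative_test_function_le:
  fixes b :: "'a::euclidean_space \<Rightarrow> 'a"
  assumes D: "has_distributional_div b D" and K: "AE x in lebesgue. norm (max 0 (- D x)) \<le> K"
    and b: "b \<in> borel_measurable lebesgue"
    and \<beta>[measurable]: "\<beta> \<in> borel_measurable borel" and eq: "AE x in lborel. b x = \<beta> x"
    and \<phi>: "test_function \<phi>" "\<And>x. 0 \<le> \<phi> x"
  shows "(\<integral>x. frechet_derivative \<phi> (at x) (\<beta> x) \<partial>lborel) \<le> K * (\<integral>x. \<phi> x \<partial>lborel)"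
proof -
  note [measurable] = borel_measurable_continuous_onI[OF continuous_test_function[OF \<phi>(1)]]
    borel_measurable_continuous_onI[OF continuous_derivative_test_function[OF \<phi>(1)]]
  let ?D = "\<lambda>x. frechet_derivative \<phi> (at x)"
  obtain r where r: "closure {x. \<phi> x \<noteq> 0} \<subseteq> cball 0 r"
    using bounded_support_test_function[OF \<phi>(1)] .
  obtain L where L: "\<And>x. \<bar>\<phi> x\<bar> \<le> L"
    using bounded_test_function[OF \<phi>(1)] by blast
  have out: "\<phi> x = 0" if "x \<notin> cball 0 r" for x
  proof -
    have "x \<notin> closure {x. \<phi> x \<noteq> 0}" using r that by blast
    from eq_0_outside_support[OF this] show ?thesis by simp
  qed
  have D\<beta>: "(\<lambda>x. ?D x (\<beta> x)) \<in> borel_measurable borel"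
    by (subst derivative_test_function_expand[OF \<phi>(1)]) measurable
  have Dm: "(\<lambda>x. ?D x i) \<in> borel_measurable lebesgue" for i
    by (intro measurable_completion) simp
  have Db: "(\<lambda>x. ?D x (b x)) \<in> borel_measurable lebesgue"
    by (subst derivative_test_function_expand[OF \<phi>(1)])
       (intro borel_measurable_sum borel_measurable_times Dm borel_measurable_inner b borel_measurable_const)
  have "(\<integral>x. ?D x (\<beta> x) \<partial>lborel) = (\<integral>x. ?D x (\<beta> x) \<partial>lebesgue)"
    using D\<beta> by (subst integral_completion) auto
  also have "\<dots> = (\<integral>x. ?D x (b x) \<partial>lebesgue)"
  proof (rule integral_cong_AE)
    have "AE x in lebesgue. b x = \<beta> x" using eq by (rule AE_completion)
    then show "AE x in lebesgue. ?D x (\<beta> x) = ?D x (b x)"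
      by (rule eventually_mono) simp
  qed (use D\<beta> Db in \<open>auto intro: measurable_completion\<close>)
  also have "\<dots> = (\<integral>x. - (\<phi> x * D x) \<partial>lebesgue)"
    using D \<phi>(1) unfolding has_distributional_div_def by simp
  also have "\<dots> \<le> (\<integral>x. K * \<phi> x \<partial>lebesgue)"
  proof (rule integral_mono_AE)
    have "set_integrable lebesgue (cball 0 r) D"
      using D unfolding has_distributional_div_def loc_integrable_def by auto
    then have D': "integrable lebesgue (\<lambda>x. indicator (cball 0 r) x *\<^sub>R D x)"
      unfolding set_integrable_def .
    have "integrable lebesgue (\<lambda>x. \<phi> x * (indicator (cball 0 r) x *\<^sub>R D x))"
    proof (rule Bochner_Integration.integrable_bound)
      show "integrable lebesgue (\<lambda>x. L * norm (indicator (cball 0 r) x *\<^sub>R D x))"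
        using D' by (intro integrable_mult_right integrable_norm)
      have "\<phi> \<in> borel_measurable lebesgue" by (intro measurable_completion) simp
      then show "(\<lambda>x. \<phi> x * (indicator (cball 0 r) x *\<^sub>R D x)) \<in> borel_measurable lebesgue"
        using D' by (intro borel_measurable_times) auto
      show "AE x in lebesgue. norm (\<phi> x * (indicator (cball 0 r) x *\<^sub>R D x)) \<le>
          norm (L * norm (indicator (cball 0 r) x *\<^sub>R D x))"
      proof (rule AE_I2)
        fix x
        show "norm (\<phi> x * (indicator (cball 0 r) x *\<^sub>R D x)) \<le>
            norm (L * norm (indicator (cball 0 r) x *\<^sub>R D x))"
          unfolding norm_mult using L[of x] by (intro mult_mono) auto
      qed
    qed
    moreover have "\<phi> x * (indicator (cball 0 r) x *\<^sub>R D x) = \<phi> x * D x" for x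
      using out[of x] by (cases "x \<in> cball 0 r") auto
    ultimately show "integrable lebesgue (\<lambda>x. - (\<phi> x * D x))"
      by (simp only: Bochner_Integration.integrable_minus)
    have "integrable lborel \<phi>"
      using L out by (intro integrable_bounded_support[where C = L and a = 0 and r = r]) auto
    then show "integrable lebesgue (\<lambda>x. K * \<phi> x)"
      by (intro integrable_mult_right) (simp add: integrable_completion)
    show "AE x in lebesgue. - (\<phi> x * D x) \<le> K * \<phi> x"
      using K
    proof (rule eventually_mono)
      fix x assume "norm (max 0 (- D x)) \<le> K"
      then have "\<phi> x * - D x \<le> \<phi> x * K"
        using \<phi>(2)[of x] by (intro mult_left_mono) auto
      then show "- (\<phi> x * D x) \<le> K * \<phi> x" by (simp add: mult.commute)
    qed
  qed
  also have "\<dots> = K * (\<integral>x. \<phi> x \<partial>lborel)"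
    by (simp add: integral_completion)
  finally show ?thesis .
qed

text \<open>One set \<open>G\<close> serves all radii; only \<open>\<nu>\<close> depends on
  \<open>\<rho>\<close>. This lets the radius be fixed later, in terms of \<open>R\<close>,
  \<open>T\<close> and \<open>M\<close>.\<close>

lemma two_sided_on_full_measure_set:
  fixes b :: "'a::euclidean_space \<Rightarrow> 'a"
  assumes b: "b \<in> borel_measurable lebesgue" and M: "\<And>x. norm (b x) \<le> M"
    and one: "one_sided_Lipschitz_on_compacts b"
    and div: "has_distributional_div b D" and D: "in_Linfty (\<lambda>x. max 0 (- D x))"
  obtains G where "negligible (- G)"
    "\<And>\<rho>. \<exists>\<nu>\<ge>0. \<forall>x\<in>G. \<forall>y\<in>G. norm x < \<rho> \<longrightarrow> norm y < \<rho> \<longrightarrow>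
      \<bar>(b x - b y) \<bullet> (x - y)\<bar> \<le> \<nu> * (norm (x - y))\<^sup>2"
proof -
  obtain g where g[measurable]: "g \<in> borel_measurable borel" and bg: "AE x in lborel. b x = g x"
    using lebesgue_measurable_ex_borel[OF b] .
  \<comment> \<open>Borel representative with the bound \<open>M\<close> at every point: where
    \<open>norm (g x) > M\<close>, \<open>g\<close> differs from \<open>b\<close>, so truncation
    changes \<open>g\<close> only on a null set.\<close>
  define \<beta> where "\<beta> x = (if norm (g x) \<le> M then g x else 0)" for x
  have \<beta>[measurable]: "\<beta> \<in> borel_measurable borel" unfolding \<beta>_def by measurable
  have "0 \<le> M" using M norm_ge_zero order_trans by blast
  then have \<beta>M: "norm (\<beta> x) \<le> M" for x by (simp add: \<beta>_def)
  have b\<beta>: "AE x in lborel. b x = \<beta> x"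
    using bg by (rule eventually_mono) (use M in \<open>auto simp: \<beta>_def; metis\<close>)
  obtain K where K: "AE x in lebesgue. norm (max 0 (- D x)) \<le> K"
    using D unfolding in_Linfty_def by blast
  have upper: "\<exists>\<nu>\<ge>0. AE z in lborel \<Otimes>\<^sub>M lborel. norm (fst z) < \<rho> \<longrightarrow> norm (snd z) < \<rho> \<longrightarrow>
      (\<beta> (fst z) - \<beta> (snd z)) \<bullet> (fst z - snd z) \<le> \<nu> * (norm (fst z - snd z))\<^sup>2" for \<rho>
  proof -
    obtain \<nu> where "AE z in (lebesgue :: ('a \<times> 'a) measure). z \<in> cball 0 \<rho> \<times> cball 0 \<rho> \<longrightarrow>
        (b (fst z) - b (snd z)) \<bullet> (fst z - snd z) \<le> \<nu> * (norm (fst z - snd z))\<^sup>2"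
      using one unfolding one_sided_Lipschitz_on_compacts_def by (meson compact_cball)
    then have "AE z in lborel \<Otimes>\<^sub>M lborel. z \<in> cball 0 \<rho> \<times> cball 0 \<rho> \<longrightarrow>
        (b (fst z) - b (snd z)) \<bullet> (fst z - snd z) \<le> \<nu> * (norm (fst z - snd z))\<^sup>2"
      by (simp only: AE_completion_iff lborel_prod)
    then have "AE z in lborel \<Otimes>\<^sub>M lborel. norm (fst z) < \<rho> \<longrightarrow> norm (snd z) < \<rho> \<longrightarrow>
      (\<beta> (fst z) - \<beta> (snd z)) \<bullet> (fst z - snd z) \<le> max 0 \<nu> * (norm (fst z - snd z))\<^sup>2"
      using AE_lborel_pair_fst_snd[OF b\<beta>]
    proof (eventually_elim, intro impI)
      fix z :: "'a \<times> 'a"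
      assume *: "z \<in> cball 0 \<rho> \<times> cball 0 \<rho> \<longrightarrow>
          (b (fst z) - b (snd z)) \<bullet> (fst z - snd z) \<le> \<nu> * (norm (fst z - snd z))\<^sup>2"
        and "b (fst z) = \<beta> (fst z) \<and> b (snd z) = \<beta> (snd z)"
        and "norm (fst z) < \<rho>" "norm (snd z) < \<rho>"
      then have "(\<beta> (fst z) - \<beta> (snd z)) \<bullet> (fst z - snd z) \<le> \<nu> * (norm (fst z - snd z))\<^sup>2"
        by (simp add: mem_Times_iff)
      also have "\<dots> \<le> max 0 \<nu> * (norm (fst z - snd z))\<^sup>2"
        by (intro mult_right_mono) auto
      finally show "(\<beta> (fst z) - \<beta> (snd z)) \<bullet> (fst z - snd z) \<le> max 0 \<nu> * (norm (fst z - snd z))\<^sup>2" .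
    qed
    then show ?thesis by (intro exI[of _ "max 0 \<nu>"]) simp
  qed
  \<comment> \<open>Estimates at essential points of \<open>\<beta>\<close> become estimates on the
    given pointwise values of \<open>b\<close>, which the scheme evaluates, once both functions
    agree there.\<close>
  define G where "G = essential_points \<beta> \<inter> {x. b x = \<beta> x}"
  have "AE x in lborel. x \<in> G"
    using AE_essential_points[OF \<beta>] b\<beta> by eventually_elim (simp add: G_def)
  then have "AE x in lebesgue. x \<in> G"
    by (rule AE_completion)
  then have "negligible (- G)"
    unfolding negligible_iff_null_sets by (simp add: completion.AE_iff_null_sets Compl_eq)
  moreover have "\<exists>\<nu>\<ge>0. \<forall>x\<in>G. \<forall>y\<in>G. norm x < \<rho> \<longrightarrow> norm y < \<rho> \<longrightarrow>
      \<bar>(b x - b y) \<bullet> (x - y)\<bar> \<le> \<nu> * (norm (x - y))\<^sup>2" for \<rho>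
  proof -
    obtain \<nu> where "0 \<le> \<nu>" "\<And>x y. x \<in> essential_points \<beta> \<Longrightarrow> y \<in> essential_points \<beta> \<Longrightarrow>
        norm x < \<rho> \<Longrightarrow> norm y < \<rho> \<Longrightarrow> \<bar>(\<beta> x - \<beta> y) \<bullet> (x - y)\<bar> \<le> \<nu> * (norm (x - y))\<^sup>2"
      using essential_points_two_sided[OF \<beta> \<beta>M upper
          integral_derivative_test_function_le[OF div K b \<beta> b\<beta>], of \<rho>] by blast
    then show ?thesis unfolding G_def by auto
  qed
  ultimately show ?thesis by (rule that)
qed

text \<open>The compression bound concerns Borel sets, so the complement of \<open>G\<close> is
  enlarged to a Borel null set \<open>Z\<close>. For each \<open>t\<close> the set of
  \<open>x\<close> with \<open>X t x\<close> in \<open>Z\<close> is then null.\<close>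

lemma regular_Lagrangian_flow_AE_in_full_measure_set:
  fixes b :: "'a::euclidean_space \<Rightarrow> 'a"
  assumes "0 \<le> T" and X: "regular_Lagrangian_flow T b X" and G: "negligible (- G)"
  shows "AE x in lborel. AE t in lborel. t \<in> {0..T} \<longrightarrow> X t x \<in> G"
proof -
  have "- G \<in> null_sets (completion lborel)"
    using G unfolding negligible_iff_null_sets .
  then obtain Z where Z: "Z \<in> null_sets lborel" "- G \<subseteq> Z"
    unfolding null_sets_completion_iff2 by auto
  then have ZX: "Z \<in> null_sets lebesgue" by (simp add: null_sets_completionI)
  obtain L where L: "\<forall>t\<in>{0..T}. \<forall>A\<in>sets borel.
        emeasure (distr lebesgue borel (X t)) A \<le> ennreal L * emeasure lebesgue A"
    using X unfolding regular_Lagrangian_flow_def by blast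
  have meas: "X t \<in> borel_measurable lebesgue" if "t \<in> {0..T}" for t
    using X that unfolding regular_Lagrangian_flow_def by blast
  have "AE x in lborel. AE t in lborel. t \<in> {0..T} \<longrightarrow> X t x \<notin> Z"
  proof (rule AE_AE_notin_continuous_process[OF \<open>0 \<le> T\<close> _ meas])
    have "AE x in lebesgue. continuous_on {0..T} (\<lambda>t. X t x)"
      using X unfolding regular_Lagrangian_flow_def
    proof (elim conjE, elim eventually_mono)
      fix x assume *: "(\<lambda>s. b (X s x)) absolutely_integrable_on {0..T} \<and>
        (\<forall>t\<in>{0..T}. X t x = x + integral {0..t} (\<lambda>s. b (X s x)))"
      then have "(\<lambda>s. b (X s x)) integrable_on {0..T}"
        using set_lebesgue_integral_eq_integral(1) by blast
      then have "continuous_on {0..T} (\<lambda>t. x + integral {0..t} (\<lambda>s. b (X s x)))"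
        by (intro continuous_intros indefinite_integral_continuous_1)
      then show "continuous_on {0..T} (\<lambda>t. X t x)"
        by (rule continuous_on_eq) (use * in simp)
    qed
    then show "AE x in lborel. continuous_on {0..T} (\<lambda>t. X t x)"
      by (simp only: AE_completion_iff)
    fix t assume t: "t \<in> {0..T}"
    have "Z \<in> sets borel" using Z(1) by (auto simp: null_sets_def)
    with L t have "emeasure (distr lebesgue borel (X t)) Z \<le> ennreal L * emeasure lebesgue Z"
      by blast
    also have "\<dots> = 0"
      using null_setsD1[OF ZX] by (simp only: mult_zero_right)
    finally have "Z \<in> null_sets (distr lebesgue borel (X t))"
      using \<open>Z \<in> sets borel\<close> by (intro null_setsI) auto
    then have "AE y in distr lebesgue borel (X t). y \<notin> Z"
      by (rule AE_not_in)
    then have "AE x in lebesgue. X t x \<notin> Z"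
      by (rule AE_distrD[OF meas[OF t]])
    then show "AE x in lborel. X t x \<notin> Z"
      by (simp only: AE_completion_iff)
  next
    show "Z \<in> sets borel" using Z(1) by (auto simp: null_sets_def)
  qed
  then show ?thesis
  proof (rule eventually_mono)
    fix x assume "AE t in lborel. t \<in> {0..T} \<longrightarrow> X t x \<notin> Z"
    then show "AE t in lborel. t \<in> {0..T} \<longrightarrow> X t x \<in> G"
      by (rule eventually_mono) (use Z(2) in auto)
  qed
qed

lemma Lp_norm_on_le_AE_bound:
  fixes f :: "'a::euclidean_space \<Rightarrow> 'b::euclidean_space"
  assumes "0 < p" "0 \<le> c" and S: "S \<in> lmeasurable"
    and f: "AE x in lebesgue. x \<in> S \<longrightarrow> norm (f x) \<le> c"
  shows "Lp_norm_on p S f \<le> ennreal (c * measure lebesgue S powr (1 / p))"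
proof -
  let ?I = "\<integral>\<^sup>+ x\<in>S. ennreal (norm (f x) powr p) \<partial>lebesgue"
  have "?I \<le> (\<integral>\<^sup>+ x. ennreal (c powr p) * indicator S x \<partial>lebesgue)"
    using f
    by (intro nn_integral_mono_AE, elim eventually_mono)
       (use \<open>0 < p\<close> in \<open>auto split: split_indicator intro!: ennreal_leI powr_mono2\<close>)
  also have "\<dots> = ennreal (c powr p) * emeasure lebesgue S"
    using S by (intro nn_integral_cmult_indicator) auto
  also have "\<dots> = ennreal (c powr p * measure lebesgue S)"
    using S by (simp add: emeasure_eq_measure2 ennreal_mult)
  finally have I: "?I \<le> ennreal (c powr p * measure lebesgue S)" .
  \<comment> \<open>Selects the finite branch of \<open>Lp_norm_on\<close>.\<close>
  then have "?I \<noteq> \<infinity>" by (auto simp: top_unique)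
  have "enn2real ?I \<le> c powr p * measure lebesgue S"
    using enn2real_mono[OF I] by simp
  then have "enn2real ?I powr (1 / p) \<le> (c powr p * measure lebesgue S) powr (1 / p)"
    using \<open>0 < p\<close> by (intro powr_mono2) auto
  also have "\<dots> = c * measure lebesgue S powr (1 / p)"
    using \<open>0 < p\<close> \<open>0 \<le> c\<close> by (cases "c = 0") (auto simp: powr_mult powr_powr)
  finally show ?thesis
    using \<open>?I \<noteq> \<infinity>\<close> unfolding Lp_norm_on_def by (simp add: Let_def ennreal_leI)
qed

lemma euler_error_AE:
  fixes b :: "'a::euclidean_space \<Rightarrow> 'a"
  assumes "0 < T" and M: "\<And>x. norm (b x) \<le> M" and X: "regular_Lagrangian_flow T b X"
    and G: "negligible (- G)"
    and two_sided: "\<And>\<rho>. \<exists>\<nu>\<ge>0. \<forall>x\<in>G. \<forall>y\<in>G. norm x < \<rho> \<longrightarrow> norm y < \<rho> \<longrightarrow>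
      \<bar>(b x - b y) \<bullet> (x - y)\<bar> \<le> \<nu> * (norm (x - y))\<^sup>2"
  obtains c where "0 \<le> c" "\<And>N n. 1 \<le> N \<Longrightarrow> n \<le> N \<Longrightarrow> AE x in lebesgue. x \<in> ball 0 R \<longrightarrow>
    norm (X (real n * (T / real N)) x - euler b (T / real N) n x) \<le> c * sqrt (T / real N)"
proof -
  have "0 \<le> M" using M norm_ge_zero order_trans by blast
  \<comment> \<open>Flow and Euler points started in the ball of radius \<open>R\<close> move at
    most \<open>T * M\<close>; the added 1 makes the containment strict.\<close>
  define \<rho> where "\<rho> = R + T * M + 1"
  obtain \<nu> where "0 \<le> \<nu>" and \<nu>: "\<And>x y. x \<in> G \<Longrightarrow> y \<in> G \<Longrightarrow> norm x < \<rho> \<Longrightarrow> norm y < \<rho> \<Longrightarrow>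
      \<bar>(b x - b y) \<bullet> (x - y)\<bar> \<le> \<nu> * (norm (x - y))\<^sup>2"
    using two_sided[of \<rho>] by blast
  define A where "A = T * (8 * M\<^sup>2 + 4 * \<nu> * T * M\<^sup>2) * exp (4 * \<nu> * T)"
  have "0 \<le> A" using \<open>0 < T\<close> \<open>0 \<le> \<nu>\<close> by (simp add: A_def)
  let ?c = "sqrt A + 2 * M * T * sqrt (2 * \<nu>)"
  have sol: "AE x in lebesgue. (\<lambda>s. b (X s x)) integrable_on {0..T} \<and>
      (\<forall>t\<in>{0..T}. X t x = x + integral {0..t} (\<lambda>s. b (X s x)))"
    using X unfolding regular_Lagrangian_flow_def
    by (elim conjE, elim eventually_mono) (auto dest: set_lebesgue_integral_eq_integral(1))
  have XG: "AE x in lebesgue. AE t in lborel. t \<in> {0..T} \<longrightarrow> X t x \<in> G"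
    using regular_Lagrangian_flow_AE_in_full_measure_set[OF _ X G] \<open>0 < T\<close> by (simp add: AE_completion)
  have X_bound: "norm (X t x - x) \<le> M * T"
    if "(\<lambda>s. b (X s x)) integrable_on {0..T}" "X t x = x + integral {0..t} (\<lambda>s. b (X s x))"
      "t \<in> {0..T}" for t x
  proof -
    have "(\<lambda>s. b (X s x)) integrable_on {0..t}"
      using that by (intro integrable_on_subinterval[OF that(1)]) auto
    then have "norm (X t x - x) \<le> M * (t - 0)"
      using integral_norm_bound_interval[of 0 t "\<lambda>s. b (X s x)" M] M that by simp
    also have "\<dots> \<le> M * T" using that(3) \<open>0 \<le> M\<close> by (intro mult_left_mono) auto
    finally show ?thesis .
  qed
  show ?thesis
  proof
    \<comment> \<open>\<open>sqrt A\<close> covers small steps; the second summand covers \<open>h * \<nu> > 1 / 2\<close>, where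
    the trivial bound \<open>2 * M * T\<close> on the error suffices.\<close>
    show "0 \<le> ?c" using \<open>0 \<le> A\<close> \<open>0 \<le> M\<close> \<open>0 < T\<close> \<open>0 \<le> \<nu>\<close> by simp
    fix N n :: nat
    assume "1 \<le> N" "n \<le> N"
    define h where "h = T / real N"
    have h: "0 < h" "h \<le> T" "real N * h = T"
      using \<open>0 < T\<close> \<open>1 \<le> N\<close> by (auto simp: h_def field_simps)
    have kh: "0 \<le> real k * h" "real k * h \<le> T" if "k \<le> N" for k
      using that h mult_right_mono[of "real k" "real N" h] by auto
    have e_bound: "norm (euler b h k x - x) \<le> M * T" if "k \<le> N" for k x
    proof -
      have "norm (euler b h k x - x) \<le> real k * h * M"
        using euler_diff_bound[of b M h k x] M h by auto
      also have "\<dots> \<le> T * M" using kh[OF that] \<open>0 \<le> M\<close> by (intro mult_right_mono)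
      finally show ?thesis by (simp add: mult.commute)
    qed
    have "AE x in lebesgue. x \<in> ball 0 R \<longrightarrow> norm (X (real n * h) x - euler b h n x) \<le> ?c * sqrt h"
    proof (cases "h * \<nu> \<le> 1 / 2")
      case True
      \<comment> \<open>The field is evaluated at the iterates with index below \<open>N\<close>, so
        only finitely many exceptional null sets are discarded for each \<open>N\<close>.\<close>
      have "AE x in lebesgue. \<forall>k\<in>{..<N}. x \<in> ball 0 R \<longrightarrow> euler b h k x \<in> G"
      proof (rule AE_finite_allI)
        fix k assume "k \<in> {..<N}"
        then have "real k * h * M \<le> T * M"
          using kh[of k] \<open>0 \<le> M\<close> by (intro mult_right_mono) auto
        then have "R + real k * h * M \<le> \<rho>" by (simp add: \<rho>_def)
        then have "negligible {x \<in> ball 0 R. euler b h k x \<in> - G}"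
          using G M h True \<nu> by (intro negligible_euler_preimage[where G = G and \<nu> = \<nu> and \<rho> = \<rho>]) auto
        then have "AE x in lebesgue. x \<notin> {x \<in> ball 0 R. euler b h k x \<in> - G}"
          unfolding negligible_iff_null_sets by (rule AE_not_in)
        then show "AE x in lebesgue. x \<in> ball 0 R \<longrightarrow> euler b h k x \<in> G"
          by (rule eventually_mono) auto
      qed simp
      with sol XG show ?thesis
      proof (eventually_elim, intro impI)
        fix x
        assume sol: "(\<lambda>s. b (X s x)) integrable_on {0..T} \<and>
            (\<forall>t\<in>{0..T}. X t x = x + integral {0..t} (\<lambda>s. b (X s x)))"
          and XG: "AE t in lborel. t \<in> {0..T} \<longrightarrow> X t x \<in> G"
          and eG: "\<forall>k\<in>{..<N}. x \<in> ball 0 R \<longrightarrow> euler b h k x \<in> G" and x: "x \<in> ball 0 R"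
        have near: "norm y < \<rho>" if "norm (y - x) \<le> M * T" for y
          using that x norm_triangle_ineq[of x "y - x"] by (simp add: \<rho>_def mult.commute)
        have "(norm (X (real n * h) x - euler b h n x))\<^sup>2 \<le> A * h"
          unfolding A_def
        proof (rule euler_error[OF M])
          fix k assume "k < N"
          show "AE s in lborel. s \<in> {0..T} \<longrightarrow> (b (X s x) - b (euler b h k x)) \<bullet> (X s x - euler b h k x)
              \<le> \<nu> * (norm (X s x - euler b h k x))\<^sup>2"
            using XG
          proof (eventually_elim, intro impI)
            fix s assume "s \<in> {0..T} \<longrightarrow> X s x \<in> G" and s: "s \<in> {0..T}"
            moreover have "norm (X s x) < \<rho>"
              using sol s by (intro near X_bound) auto
            moreover have "norm (euler b h k x) < \<rho>"
              using \<open>k < N\<close> by (intro near e_bound) auto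
            ultimately show "(b (X s x) - b (euler b h k x)) \<bullet> (X s x - euler b h k x)
                \<le> \<nu> * (norm (X s x - euler b h k x))\<^sup>2"
              using \<nu>[of "X s x" "euler b h k x"] eG x \<open>k < N\<close> by auto
          qed
        qed (use sol h \<open>0 \<le> \<nu>\<close> \<open>n \<le> N\<close> in auto)
        then have "norm (X (real n * h) x - euler b h n x) \<le> sqrt A * sqrt h"
          by (simp add: real_le_rsqrt flip: real_sqrt_mult)
        also have "\<dots> \<le> ?c * sqrt h"
          using \<open>0 \<le> M\<close> \<open>0 < T\<close> \<open>0 \<le> \<nu>\<close> h by (intro mult_right_mono) auto
        finally show "norm (X (real n * h) x - euler b h n x) \<le> ?c * sqrt h" .
      qed
    next
      case False
      then have "1 \<le> 2 * (h * \<nu>)" by linarith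
      then have "1 \<le> sqrt (2 * \<nu> * h)" by (simp add: mult_ac)
      show ?thesis
        using sol
      proof (eventually_elim, intro impI)
        fix x
        assume sol: "(\<lambda>s. b (X s x)) integrable_on {0..T} \<and>
            (\<forall>t\<in>{0..T}. X t x = x + integral {0..t} (\<lambda>s. b (X s x)))"
        have "norm (X (real n * h) x - x) \<le> M * T"
          using sol kh[OF \<open>n \<le> N\<close>] by (intro X_bound) auto
        then have "norm (X (real n * h) x - euler b h n x) \<le> 2 * M * T * 1"
          using e_bound[OF \<open>n \<le> N\<close>, of x]
            norm_triangle_ineq4[of "X (real n * h) x - x" "euler b h n x - x"] by simp
        also have "\<dots> \<le> 2 * M * T * sqrt (2 * \<nu> * h)"
          using \<open>1 \<le> sqrt (2 * \<nu> * h)\<close> \<open>0 \<le> M\<close> \<open>0 < T\<close> by (intro mult_left_mono) auto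
        also have "\<dots> = 2 * M * T * sqrt (2 * \<nu>) * sqrt h"
          by (simp add: real_sqrt_mult)
        also have "\<dots> \<le> ?c * sqrt h"
          using \<open>0 \<le> A\<close> h by (intro mult_right_mono) auto
        finally show "norm (X (real n * h) x - euler b h n x) \<le> ?c * sqrt h" .
      qed
    qed
    then show "AE x in lebesgue. x \<in> ball 0 R \<longrightarrow>
        norm (X (real n * (T / real N)) x - euler b (T / real N) n x) \<le> ?c * sqrt (T / real N)"
      by (simp only: h_def)
  qed
qed

theorem theorem3p1:
  fixes T R p :: real
    and b :: "real ^ 'd \<Rightarrow> real ^ 'd"
    and D :: "real ^ 'd \<Rightarrow> real"
    and X :: "real \<Rightarrow> real ^ 'd \<Rightarrow> real ^ 'd"
  assumes "T > 0" and "R > 0" and "p > 1"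
    and "bounded (range b)"
    and "in_W1p p b"
    and "one_sided_Lipschitz_on_compacts b"
    and "has_distributional_div b D"
    and "in_Linfty (\<lambda>x. max 0 (- D x))"
    and "regular_Lagrangian_flow T b X"
  shows "\<exists>C \<kappa> K :: real. C > 0 \<and> \<kappa> > 0 \<and> K \<ge> 0 \<and>
    (let t0 = 0;
         Cexp = exp ((T - t0) * (2 * \<kappa> + K * (T - t0)))
     in \<forall>N::nat. N \<ge> 1 \<longrightarrow>
       (let h = T / real N
        in \<forall>n\<in>{0..N}.
          Lp_norm_on p (ball 0 R) (\<lambda>x. X (real n * h) x - euler b h n x)
            \<le> ennreal (C * sqrt ((Cexp - 1) / (2 * \<kappa>)) * h powr (1 / 2))
              + ennreal Cexp * Lp_norm_on p (ball 0 R) (\<lambda>x. X t0 x - euler b h 0 x)))"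
proof -
  have b: "b \<in> borel_measurable lebesgue"
    using \<open>in_W1p p b\<close> by (simp add: in_W1p_def in_Lp_def)
  obtain M where M: "\<And>x. norm (b x) \<le> M"
    using \<open>bounded (range b)\<close> unfolding bounded_iff by auto
  obtain G where G: "negligible (- G)"
    "\<And>\<rho>. \<exists>\<nu>\<ge>0. \<forall>x\<in>G. \<forall>y\<in>G. norm x < \<rho> \<longrightarrow> norm y < \<rho> \<longrightarrow>
      \<bar>(b x - b y) \<bullet> (x - y)\<bar> \<le> \<nu> * (norm (x - y))\<^sup>2"
    using two_sided_on_full_measure_set[OF b M assms(6,7,8)] by blast
  obtain c where "0 \<le> c" and c: "\<And>N n. 1 \<le> N \<Longrightarrow> n \<le> N \<Longrightarrow> AE x in lebesgue. x \<in> ball 0 R \<longrightarrow>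
      norm (X (real n * (T / real N)) x - euler b (T / real N) n x) \<le> c * sqrt (T / real N)"
    using euler_error_AE[OF \<open>T > 0\<close> M assms(9) G, where R = R] by blast
  \<comment> \<open>Value of the square root in the claim for \<open>\<kappa> = 1\<close> and
    \<open>K = 0\<close>. It is positive because \<open>T > 0\<close>, so \<open>C\<close> can be
    divided by it.\<close>
  define s where "s = sqrt ((exp (T * 2) - 1) / 2)"
  have "0 < s" using \<open>T > 0\<close> by (simp add: s_def)
  define m where "m = measure lebesgue (ball 0 R :: (real ^ 'd) set) powr (1 / p)"
  have "0 \<le> m" by (simp add: m_def)
  \<comment> \<open>Chosen so that \<open>C * s\<close> is \<open>c * m + 1\<close>; the summand 1
    makes \<open>C\<close> positive even if \<open>c * m = 0\<close>.\<close>
  define C where "C = (c * m + 1) / s"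
  have "0 < C"
    using \<open>0 \<le> c\<close> \<open>0 \<le> m\<close> \<open>0 < s\<close> by (simp add: C_def add_nonneg_pos)
  show ?thesis
  proof (intro exI conjI)
    show "0 < C" "(0 :: real) < 1" "(0 :: real) \<le> 0"
      using \<open>0 < C\<close> by simp_all
    show "let t0 = 0;
         Cexp = exp ((T - t0) * (2 * 1 + 0 * (T - t0)))
     in \<forall>N::nat. N \<ge> 1 \<longrightarrow>
       (let h = T / real N
        in \<forall>n\<in>{0..N}.
          Lp_norm_on p (ball 0 R) (\<lambda>x. X (real n * h) x - euler b h n x)
            \<le> ennreal (C * sqrt ((Cexp - 1) / (2 * 1)) * h powr (1 / 2))
              + ennreal Cexp * Lp_norm_on p (ball 0 R) (\<lambda>x. X t0 x - euler b h 0 x))"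
      unfolding Let_def
    \<comment> \<open>The initial error contributes a nonnegative second summand, so a bound by the
      first summand is enough.\<close>
    proof (intro allI impI ballI add_increasing2[OF zero_le])
      fix N n :: nat
      assume "1 \<le> N" and n: "n \<in> {0..N}"
      have "Lp_norm_on p (ball 0 R) (\<lambda>x. X (real n * (T / real N)) x - euler b (T / real N) n x)
          \<le> ennreal (c * sqrt (T / real N) * m)"
        unfolding m_def using \<open>p > 1\<close> \<open>T > 0\<close> \<open>0 \<le> c\<close> \<open>1 \<le> N\<close> n
        by (intro Lp_norm_on_le_AE_bound c) auto
      also have "c * sqrt (T / real N) * m \<le> (c * m + 1) * sqrt (T / real N)"
        using \<open>T > 0\<close> by (simp add: distrib_right)
      also have "\<dots> = C * s * (T / real N) powr (1 / 2)"
        using \<open>0 < s\<close> \<open>T > 0\<close> by (simp add: C_def powr_half_sqrt)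
      also have "s = sqrt ((exp ((T - 0) * (2 * 1 + 0 * (T - 0))) - 1) / (2 * 1))"
        by (simp add: s_def)
      finally show "Lp_norm_on p (ball 0 R) (\<lambda>x. X (real n * (T / real N)) x - euler b (T / real N) n x)
          \<le> ennreal (C * sqrt ((exp ((T - 0) * (2 * 1 + 0 * (T - 0))) - 1) / (2 * 1)) *
            (T / real N) powr (1 / 2))"
        by (simp add: ennreal_leI)
    qed
  qed
qed

end
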